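(* Assume that $E=I_n+BK_DC$ is nonsingular. Let $\mu_1,\dots,\mu_{n+p}$ be the eigenvalues of $A_{\rm id}$, counted with algebraic multiplicity, and let $\nu_1,\dots,\nu_p$ be the eigenvalues of $M_D=CBK_D$, counted with algebraic multiplicity. Then, for all sufficiently small $h>0$, the eigenvalues of $\mathcal A_h$ (counted with algebraic multiplicity) can be labeled as $\lambda_1(h),\dots,\lambda_{n+2p}(h)$ so that, as $h\to0^+$, $$\lambda_j(h)=1+h\mu_j+o(h),\qquad j=1,\dots,n+p,$$ and $$\lambda_{n+p+\ell}(h)\to-\nu_\ell,\qquad \ell=1,\dots,p.$$
   Context: Fix positive integers $n,m,p$ and real matrices $A\in\mathbb R^{n\times n}$, $B\in\mathbb R^{n\times m}$, $C\in\mathbb R^{p\times n}$ (the plant $\dot x=Ax+Bu$, $y=Cx$) and gains $K_P,K_I,K_D\in\mathbb R^{m\times p}$. Set $E=I_n+BK_DC$ and $M_D=CBK_D\in\mathbb R^{p\times p}$. When $E$ is nonsingular, the ideal PID closed-loop matrix is $$A_{\rm id}=\begin{bmatrix}E^{-1}(A-BK_PC)&-E^{-1}BK_I\\ C&0\end{bmatrix}\in\mathbb R^{(n+p)\times(n+p)}.$$ For a sampling period $h>0$, let $\Phi_h=e^{Ah}$ and $\Gamma_h=\int_0^h e^{A\tau}\,d\tau$, and define the lifted matrix of the sampled PID implementation with backward differences $$\mathcal A_h=\begin{bmatrix}\Phi_h-\Gamma_hB(K_P+h^{-1}K_D)C&-\Gamma_hBK_I&h^{-1}\Gamma_hBK_D\\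 hC&I_p&0\\ C&0&0\end{bmatrix}\in\mathbb R^{(n+2p)\times(n+2p)}.$$ Eigenvalues are taken in $\mathbb C$. *)

theory Defs
  imports
    "HOL-Analysis.Analysis"
    "HOL-Library.Landau_Symbols"
    "Jordan_Normal_Form.Char_Poly"
    "Jordan_Normal_Form.Gauss_Jordan_Elimination"
begin

definition eigenvalues_mset :: "real mat \<Rightarrow> complex multiset" where
  "eigenvalues_mset M = proots (char_poly (map_mat complex_of_real M))"

text \<open>The value \<^const>\<open>mat_inverse\<close> returns is an option; it is
  \<^const>\<open>None\<close> exactly when the square matrix is singular, so \<open>mat_inv\<close> is
  meaningful for nonsingular arguments only.\<close>

definition mat_inv :: "real mat \<Rightarrow> real mat" where
  "mat_inv M = the (mat_inverse M)"

text \<open>The type \<^typ>\<open>real mat\<close> is not a normed algebra, so that the generic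
  exponential and integral do not apply to it directly; both are taken entrywise.\<close>

definition mat_exp :: "real mat \<Rightarrow> real mat" where
  "mat_exp M = mat (dim_row M) (dim_row M) (\<lambda>(i,j). \<Sum>k. (M ^\<^sub>m k) $$ (i,j) / fact k)"

definition \<Phi> :: "real mat \<Rightarrow> real \<Rightarrow> real mat" where
  "\<Phi> A h = mat_exp (h \<cdot>\<^sub>m A)"

definition \<Gamma> :: "real mat \<Rightarrow> real \<Rightarrow> real mat" where
  "\<Gamma> A h = mat (dim_row A) (dim_row A)
     (\<lambda>(i,j). integral {0..h} (\<lambda>\<tau>. mat_exp (\<tau> \<cdot>\<^sub>m A) $$ (i,j)))"

definition E_mat :: "real mat \<Rightarrow> real mat \<Rightarrow> real mat \<Rightarrow> real mat \<Rightarrow> real mat" where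
  "E_mat A B C KD = 1\<^sub>m (dim_row A) + B * KD * C"

definition A_id ::
  "real mat \<Rightarrow> real mat \<Rightarrow> real mat \<Rightarrow> real mat \<Rightarrow> real mat \<Rightarrow> real mat \<Rightarrow> real mat" where
  "A_id A B C KP KI KD =
     (let Ei = mat_inv (E_mat A B C KD); p = dim_row C
      in four_block_mat
           (Ei * (A - B * KP * C)) (- (Ei * B * KI))
           C                       (0\<^sub>m p p))"

text \<open>The block rows and columns have sizes \<open>n, p, p\<close>. The outer partition is
  \<open>(n + p) + p\<close>, and the third block row \<open>[C  0]\<close> is completed by blocks of height zero.\<close>

definition A_lift ::
  "real mat \<Rightarrow> real mat \<Rightarrow> real mat \<Rightarrow> real mat \<Rightarrow> real mat \<Rightarrow> real mat \<Rightarrow> real \<Rightarrow> real mat" where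
  "A_lift A B C KP KI KD h =
     (let n = dim_row A; p = dim_row C; G = \<Gamma> A h
      in four_block_mat
           (four_block_mat
              (\<Phi> A h - G * B * (KP + inverse h \<cdot>\<^sub>m KD) * C) (- (G * B * KI))
              (h \<cdot>\<^sub>m C)                                       (1\<^sub>m p))
           (inverse h \<cdot>\<^sub>m (G * B * KD) @\<^sub>r 0\<^sub>m p p)
           (four_block_mat C (0\<^sub>m p p) (0\<^sub>m 0 n) (0\<^sub>m 0 p))
           (0\<^sub>m p p))"

end

theory Submission
  imports Defs
begin

text \<open>
  Write \<open>G = \<Gamma>\<^sub>h / h\<close> and \<open>F = (\<Phi>\<^sub>h - I) / h\<close>, which tend to \<open>I\<close> and \<open>A\<close> as \<open>h\<close> tends to \<open>0\<close>. With
  \<open>R = [C 0]\<close>, with \<open>Y\<close> the column of blocks \<open>G B K\<^sub>D\<close> and \<open>0\<close>, and with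
  \<open>V = [[F - G B K\<^sub>P C, - G B K\<^sub>I], [C, 0]]\<close>, the lifted matrix takes the slow-fast form
  \<open>[[I + h V - Y R, Y], [R, 0]]\<close> (lemma \<open>A_lift_sheared\<close>). Put \<open>N = n + p\<close>. One column operation shows
  that its characteristic polynomial at \<open>z\<close> is the determinant of
  \<open>[[(z - 1) I - h V, - Y], [(z - 1) R, z I]]\<close>, and from this expression two limits are visible.

  For fixed \<open>z\<close> the determinant tends to \<open>(z - 1) ^ N det (z I + R Y)\<close>, where the limit of \<open>R Y\<close> is
  \<open>C B K\<^sub>D\<close>. So \<open>N\<close> eigenvalues tend to \<open>1\<close> and the others tend to the numbers \<open>- \<nu>\<close>. To resolve the first group,
  put \<open>z = 1 + h s\<close> and divide by \<open>h ^ N\<close>; the limit is \<open>det (s (I + Y R) - V)\<close> at \<open>h = 0\<close>. Here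
  \<open>I + Y R\<close> is \<open>E\<close> bordered by an identity block and \<open>V\<close> is its product with \<open>A\<^sub>i\<^sub>d\<close>, so the limit is
  \<open>det E\<close> times the characteristic polynomial of \<open>A\<^sub>i\<^sub>d\<close> at \<open>s\<close>. Nonsingularity of \<open>E\<close> makes this limit a
  polynomial of exact degree \<open>N\<close>, and the rescaled eigenvalues \<open>(\<lambda> - 1) / h\<close> that stay bounded tend to
  its roots \<open>\<mu>\<close>.

  Passing from polynomials to labelled roots is theorem \<open>roots_converge\<close>. It is elementary: the root
  nearest to a root of the limit must converge to it, and its linear factor can then be divided out.
  It tolerates a leading coefficient that tends to zero, as happens in the variable \<open>s\<close>, where \<open>p\<close>
  roots may escape to infinity. Theorem \<open>slow_fast_eigenvalues\<close> combines the two limits into one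
  labelling: the slow roots are labelled and removed before the fast ones are labelled.
\<close>

section \<open>Continuity of polynomial roots when the degree may drop\<close>

text \<open>A polynomial of degree at most \<open>K\<close> depends continuously on its values at \<open>K + 1\<close> points,
  so pointwise convergence away from a finite set cannot fail on that set. The induction divides
  by \<open>X - a\<close> for an admissible point \<open>a\<close>, which lowers the degree bound and adds \<open>a\<close> to the
  exceptional set.\<close>
lemma poly_null_family_extends:
  fixes P :: "'a \<Rightarrow> 'b::real_normed_field poly"
  assumes "\<forall>\<^sub>F h in F. degree (P h) \<le> K" and "finite S"
    and "\<And>z. z \<notin> S \<Longrightarrow> ((\<lambda>h. poly (P h) z) \<longlongrightarrow> 0) F"
  shows "((\<lambda>h. poly (P h) z) \<longlongrightarrow> 0) F"
  using assms
proof (induction K arbitrary: P S z)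
  case 0
  obtain a where a: "a \<notin> S"
    using ex_new_if_finite[OF infinite_UNIV_char_0 0(2)] by blast
  have "\<forall>\<^sub>F h in F. poly (P h) a = poly (P h) z"
    using 0(1)
  proof eventually_elim
    case (elim h)
    then obtain c where "P h = [:c:]" using degree_eq_zeroE by blast
    then show ?case by simp
  qed
  then show ?case using 0(3)[OF a] by (rule Lim_transform_eventually[rotated])
next
  case (Suc K)
  obtain a where a: "a \<notin> S"
    using ex_new_if_finite[OF infinite_UNIV_char_0 Suc.prems(2)] by blast
  define D where "D h = synthetic_div (P h) a" for h
  have split: "poly (P h) w = poly (P h) a + (w - a) * poly (D h) w" for h w
  proof -
    have "P h + Polynomial.smult a (D h) = pCons (poly (P h) a) (D h)"
      unfolding D_def by (rule synthetic_div_correct)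
    then have "poly (P h + Polynomial.smult a (D h)) w = poly (pCons (poly (P h) a) (D h)) w" by simp
    then show ?thesis by (simp add: algebra_simps)
  qed
  have "((\<lambda>h. poly (D h) w) \<longlongrightarrow> 0) F" for w
  proof (rule Suc.IH[where S = "insert a S"])
    show "\<forall>\<^sub>F h in F. degree (D h) \<le> K"
      using Suc.prems(1) by eventually_elim (simp add: D_def degree_synthetic_div)
    show "finite (insert a S)" using Suc.prems(2) by simp
    fix u assume u: "u \<notin> insert a S"
    have "((\<lambda>h. (poly (P h) u - poly (P h) a) / (u - a)) \<longlongrightarrow> (0 - 0) / (u - a)) F"
      using u a by (intro tendsto_intros Suc.prems(3)) auto
    moreover have "(poly (P h) u - poly (P h) a) / (u - a) = poly (D h) u" for h
      using split[of h u] u by auto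
    ultimately show "((\<lambda>h. poly (D h) u) \<longlongrightarrow> 0) F" by simp
  qed
  from tendsto_add[OF Suc.prems(3)[OF a] tendsto_mult_left[OF this, of "z - a" z]]
  show ?case unfolding split[of _ z] by simp
qed

text \<open>The form in which the previous lemma is applied. Quotients by linear factors have a limit
  only away from the limit of the removed root; this fills in the missing point.\<close>
lemma prod_linear_limit_extends:
  fixes M :: "'a \<Rightarrow> complex multiset" and r :: "'i \<Rightarrow> complex"
  assumes "\<forall>\<^sub>F h in F. size (M h) \<le> K" and "finite S"
    and "\<And>z. z \<notin> S \<Longrightarrow>
      ((\<lambda>h. c h * (\<Prod>x\<in>#M h. z - x)) \<longlongrightarrow> c0 * (\<Prod>j\<in>J. z - r j)) F"
  shows "((\<lambda>h. c h * (\<Prod>x\<in>#M h. z - x)) \<longlongrightarrow> c0 * (\<Prod>j\<in>J. z - r j)) F"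
proof -
  define Q where "Q = Polynomial.smult c0 (\<Prod>j\<in>J. [:- r j, 1:])"
  define P where "P h = Polynomial.smult (c h) (\<Prod>x\<in>#M h. [:- x, 1:])" for h
  have deg: "degree (\<Prod>x\<in>#N. [:- x, 1:]) \<le> size N" for N :: "complex multiset"
  proof (induction N)
    case (add x N)
    have "degree ([:- x, 1:] * (\<Prod>x\<in>#N. [:- x, 1:])) \<le> degree [:- x, 1:] + size N"
      using degree_mult_le add by (meson add_left_mono order_trans)
    then show ?case by simp
  qed simp
  have evalM: "poly (\<Prod>x\<in>#N. [:- x, 1:]) w = (\<Prod>x\<in>#N. w - x)" for N :: "complex multiset" and w
    by (induction N) (auto simp: algebra_simps)
  have evalP: "poly (P h) w = c h * (\<Prod>x\<in>#M h. w - x)" for h w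
    by (simp add: P_def evalM)
  have evalQ: "poly Q w = c0 * (\<Prod>j\<in>J. w - r j)" for w
    by (simp add: Q_def poly_prod)
  have "((\<lambda>h. poly (P h - Q) z) \<longlongrightarrow> 0) F"
  proof (rule poly_null_family_extends[where S = S and K = "max K (degree Q)"])
    show "\<forall>\<^sub>F h in F. degree (P h - Q) \<le> max K (degree Q)"
      using assms(1)
    proof eventually_elim
      case (elim h)
      have "degree (P h) \<le> K"
        using degree_smult_le[of "c h"] deg[of "M h"] elim unfolding P_def
        by (meson order_trans)
      then show ?case using degree_diff_le_max[of "P h" Q] by linarith
    qed
    show "((\<lambda>h. poly (P h - Q) w) \<longlongrightarrow> 0) F" if "w \<notin> S" for w
      using assms(3)[OF that] unfolding poly_diff evalP evalQ by (rule LIM_zero)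
  qed (rule assms(2))
  then show ?thesis unfolding poly_diff evalP evalQ by (rule LIM_zero_cancel)
qed

text \<open>If \<open>a\<close> stays at distance \<open>\<epsilon>\<close> from every root, then every factor satisfies
  \<open>|z - x| \<le> |a - x| + |z - a| \<le> |a - x| (1 + |z - a| / \<epsilon>)\<close>. This quantitative statement takes
  the place of Rouche's theorem.\<close>
lemma prod_linear_growth:
  fixes N :: "complex multiset"
  assumes "\<epsilon> > 0" and "\<And>x. x \<in># N \<Longrightarrow> \<epsilon> \<le> dist x a"
  shows "norm (\<Prod>x\<in>#N. z - x) \<le> norm (\<Prod>x\<in>#N. a - x) * (1 + norm (z - a) / \<epsilon>) ^ size N"
  using assms(2)
proof (induction N)
  case (add x N)
  have x: "\<epsilon> \<le> norm (a - x)" using add.prems[of x] by (simp add: dist_norm norm_minus_commute)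
  have "norm (z - x) \<le> norm (a - x) + norm (z - a)"
    using norm_triangle_ineq[of "a - x" "z - a"] by simp
  also have "norm (z - a) \<le> norm (a - x) * (norm (z - a) / \<epsilon>)"
    using mult_right_mono[OF x, of "norm (z - a) / \<epsilon>"] \<open>\<epsilon> > 0\<close> by simp
  finally have step: "norm (z - x) \<le> norm (a - x) * (1 + norm (z - a) / \<epsilon>)"
    by (simp add: algebra_simps)
  have "norm (z - x) * norm (\<Prod>x\<in>#N. z - x) \<le>
      (norm (a - x) * (1 + norm (z - a) / \<epsilon>)) *
      (norm (\<Prod>x\<in>#N. a - x) * (1 + norm (z - a) / \<epsilon>) ^ size N)"
    using add \<open>\<epsilon> > 0\<close> by (intro mult_mono step) auto
  then show ?case by (simp add: norm_mult mult_ac)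
qed simp

text \<open>If the roots nearest to \<open>a\<close> kept a distance \<open>\<epsilon>\<close>, the growth bound would force the values at
  \<open>z\<close> to vanish in the limit together with those at \<open>a\<close>. The leading factor \<open>c h\<close> cancels in this
  comparison, so it may tend to zero: roots that escape to infinity do no harm.\<close>
lemma nearest_root_tendsto:
  fixes M :: "'a \<Rightarrow> complex multiset"
  assumes size: "\<forall>\<^sub>F h in F. size (M h) \<le> K"
    and at_a: "((\<lambda>h. c h * (\<Prod>x\<in>#M h. a - x)) \<longlongrightarrow> 0) F"
    and at_z: "((\<lambda>h. c h * (\<Prod>x\<in>#M h. z - x)) \<longlongrightarrow> L) F" and "L \<noteq> 0"
  obtains \<sigma> where "\<forall>\<^sub>F h in F. \<sigma> h \<in># M h" and "(\<sigma> \<longlongrightarrow> a) F"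
proof -
  have near: "\<forall>\<^sub>F h in F. \<exists>x\<in>#M h. dist x a < \<epsilon>" if "\<epsilon> > 0" for \<epsilon>
  proof -
    define q where "q = (1 + norm (z - a) / \<epsilon>) ^ K"
    have "((\<lambda>h. norm (c h * (\<Prod>x\<in>#M h. z - x)) - norm (c h * (\<Prod>x\<in>#M h. a - x)) * q)
        \<longlongrightarrow> norm L - norm (0::complex) * q) F"
      by (intro tendsto_intros at_a at_z)
    moreover have "norm L - norm (0::complex) * q > 0" using \<open>L \<noteq> 0\<close> by simp
    ultimately have "\<forall>\<^sub>F h in F.
        norm (c h * (\<Prod>x\<in>#M h. z - x)) - norm (c h * (\<Prod>x\<in>#M h. a - x)) * q > 0"
      by (rule order_tendstoD)
    then show ?thesis using size
    proof eventually_elim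
      case (elim h)
      show ?case
      proof (rule ccontr)
        assume "\<not> (\<exists>x\<in>#M h. dist x a < \<epsilon>)"
        then have "norm (\<Prod>x\<in>#M h. z - x)
            \<le> norm (\<Prod>x\<in>#M h. a - x) * (1 + norm (z - a) / \<epsilon>) ^ size (M h)"
          by (intro prod_linear_growth that) (auto simp: not_less)
        also have "\<dots> \<le> norm (\<Prod>x\<in>#M h. a - x) * q"
          unfolding q_def using that elim(2) by (intro mult_left_mono power_increasing) auto
        finally show False
          using elim(1) mult_left_mono[of _ _ "norm (c h)"] by (force simp: norm_mult mult.assoc)
      qed
    qed
  qed
  define \<sigma> where "\<sigma> h = arg_min_on (\<lambda>x. dist x a) (set_mset (M h))" for h
  have mem: "\<sigma> h \<in># M h" and le: "\<And>x. x \<in># M h \<Longrightarrow> dist (\<sigma> h) a \<le> dist x a"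
    if "M h \<noteq> {#}" for h
    using that arg_min_if_finite(1)[of "set_mset (M h)" "\<lambda>x. dist x a"]
      arg_min_least[of "set_mset (M h)" _ "\<lambda>x. dist x a"]
    unfolding \<sigma>_def by auto
  show ?thesis
  proof
    show "\<forall>\<^sub>F h in F. \<sigma> h \<in># M h"
      using near[of 1] by (auto elim!: eventually_mono intro: mem)
    show "(\<sigma> \<longlongrightarrow> a) F"
    proof (rule tendstoI)
      fix \<epsilon> :: real assume "\<epsilon> > 0"
      from near[OF this] show "\<forall>\<^sub>F h in F. dist (\<sigma> h) a < \<epsilon>"
        by eventually_elim (metis empty_iff le order_le_less_trans set_mset_empty)
    qed
  qed
qed

text \<open>The roots of the limit are treated one after the other: the nearest root of the approximating
  polynomial is selected, its linear factor is divided out, and the quotients converge to the quotient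
  of the limit. Repeated roots of the limit are thereby matched by as many separate roots, and since
  nothing is required of the roots left over at the end, the degree may drop in the limit.\<close>
theorem roots_converge:
  fixes M :: "'a \<Rightarrow> complex multiset" and r :: "'i \<Rightarrow> complex"
  assumes "finite J" and "\<forall>\<^sub>F h in F. size (M h) \<le> K" and "c0 \<noteq> 0" and "finite S"
    and "\<And>z. z \<notin> S \<Longrightarrow>
      ((\<lambda>h. c h * (\<Prod>x\<in>#M h. z - x)) \<longlongrightarrow> c0 * (\<Prod>j\<in>J. z - r j)) F"
  shows "\<exists>\<sigma>. (\<forall>\<^sub>F h in F. image_mset (\<lambda>j. \<sigma> j h) (mset_set J) \<subseteq># M h) \<and>
             (\<forall>j\<in>J. (\<sigma> j \<longlongrightarrow> r j) F)"
  using assms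
proof (induction J arbitrary: M S K rule: finite_induct)
  case empty
  show ?case by simp
next
  case (insert i J)
  note lim = prod_linear_limit_extends[OF insert.prems(1,3,4)]
  obtain z where z: "z \<notin> r ` insert i J"
    using ex_new_if_finite[OF infinite_UNIV_char_0, of "r ` insert i J"] insert.hyps by blast
  have zero: "(\<Prod>j\<in>insert i J. r i - r j) = 0" and nz: "c0 * (\<Prod>j\<in>insert i J. z - r j) \<noteq> 0"
    using insert.hyps z insert.prems(2) by auto
  obtain \<sigma>i where mem: "\<forall>\<^sub>F h in F. \<sigma>i h \<in># M h" and tend: "(\<sigma>i \<longlongrightarrow> r i) F"
    using nearest_root_tendsto[OF insert.prems(1) _ lim nz, where a = "r i"] lim[of "r i"] zero by auto
  define M' where "M' h = M h - {#\<sigma>i h#}" for h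
  have "\<exists>\<sigma>. (\<forall>\<^sub>F h in F. image_mset (\<lambda>j. \<sigma> j h) (mset_set J) \<subseteq># M' h) \<and>
             (\<forall>j\<in>J. (\<sigma> j \<longlongrightarrow> r j) F)"
  proof (rule insert.IH[where S = "{r i}"])
    show "\<forall>\<^sub>F h in F. size (M' h) \<le> K"
      using insert.prems(1) by eventually_elim
        (use size_mset_mono[OF diff_subset_eq_self] in \<open>force simp: M'_def intro: order_trans\<close>)
    show "c0 \<noteq> 0" "finite {r i}" using insert.prems by auto
    fix w assume w: "w \<notin> {r i}"
    \<comment> \<open>Dividing by the selected factor is harmless away from the limit root \<open>r i\<close>, which becomes the
      exceptional set of the smaller problem.\<close>
    have quot: "((\<lambda>h. (c h * (\<Prod>x\<in>#M h. w - x)) / (w - \<sigma>i h))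
        \<longlongrightarrow> (c0 * (\<Prod>j\<in>insert i J. w - r j)) / (w - r i)) F"
      using w by (intro tendsto_intros lim tend) auto
    have "(c0 * (\<Prod>j\<in>insert i J. w - r j)) / (w - r i) = c0 * (\<Prod>j\<in>J. w - r j)"
      using insert.hyps w by simp
    note quot = quot[unfolded this]
    have "\<forall>\<^sub>F h in F. \<sigma>i h \<noteq> w"
      using tendsto_imp_eventually_ne[OF tend] w by auto
    with mem have "\<forall>\<^sub>F h in F. (c h * (\<Prod>x\<in>#M h. w - x)) / (w - \<sigma>i h) = c h * (\<Prod>x\<in>#M' h. w - x)"
    proof eventually_elim
      case (elim h)
      then obtain N where "M h = add_mset (\<sigma>i h) N" by (blast dest: multi_member_split)
      then show ?case using elim by (simp add: M'_def)
    qed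
    with quot show "((\<lambda>h. c h * (\<Prod>x\<in>#M' h. w - x)) \<longlongrightarrow> c0 * (\<Prod>j\<in>J. w - r j)) F"
      by (rule Lim_transform_eventually)
  qed
  then obtain \<sigma> where \<sigma>: "\<forall>\<^sub>F h in F. image_mset (\<lambda>j. \<sigma> j h) (mset_set J) \<subseteq># M' h"
    "\<And>j. j \<in> J \<Longrightarrow> (\<sigma> j \<longlongrightarrow> r j) F" by blast
  show ?case
  proof (intro exI[of _ "\<sigma>(i := \<sigma>i)"] conjI ballI)
    show "\<forall>\<^sub>F h in F. image_mset (\<lambda>j. (\<sigma>(i := \<sigma>i)) j h) (mset_set (insert i J)) \<subseteq># M h"
      using mem \<sigma>(1)
    proof eventually_elim
      case (elim h)
      have "image_mset (\<lambda>j. (\<sigma>(i := \<sigma>i)) j h) (mset_set J) = image_mset (\<lambda>j. \<sigma> j h) (mset_set J)"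
        using insert.hyps by (intro image_mset_cong) auto
      then have "image_mset (\<lambda>j. (\<sigma>(i := \<sigma>i)) j h) (mset_set (insert i J))
          = add_mset (\<sigma>i h) (image_mset (\<lambda>j. \<sigma> j h) (mset_set J))"
        using insert.hyps by simp
      also have "\<dots> \<subseteq># M h"
        using elim unfolding M'_def by (metis insert_DiffM mset_subset_eq_add_mset_cancel)
      finally show ?case .
    qed
    show "((\<sigma>(i := \<sigma>i)) j \<longlongrightarrow> r j) F" if "j \<in> insert i J" for j
      using that \<sigma>(2) tend by auto
  qed
qed

section \<open>Entrywise limits of matrices\<close>

text \<open>The dimensions are arguments because matrices of unspecified size carry no topology; fixing
  them for every parameter value turns the limit laws below into plain introduction rules.\<close>
definition mat_tendsto ::
  "nat \<Rightarrow> nat \<Rightarrow> ('a \<Rightarrow> 'b::topological_space mat) \<Rightarrow> 'b mat \<Rightarrow> 'a filter \<Rightarrow> bool" where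
  "mat_tendsto nr nc X L F \<longleftrightarrow> (\<forall>h. X h \<in> carrier_mat nr nc) \<and> L \<in> carrier_mat nr nc \<and>
     (\<forall>i<nr. \<forall>j<nc. ((\<lambda>h. X h $$ (i,j)) \<longlongrightarrow> L $$ (i,j)) F)"

lemma mat_tendstoI:
  assumes "\<And>h. X h \<in> carrier_mat nr nc" "L \<in> carrier_mat nr nc"
    and "\<And>i j. i < nr \<Longrightarrow> j < nc \<Longrightarrow> ((\<lambda>h. X h $$ (i,j)) \<longlongrightarrow> L $$ (i,j)) F"
  shows "mat_tendsto nr nc X L F"
  using assms unfolding mat_tendsto_def by blast

lemma mat_tendstoD:
  assumes "mat_tendsto nr nc X L F"
  shows "X h \<in> carrier_mat nr nc" "L \<in> carrier_mat nr nc"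
    and "i < nr \<Longrightarrow> j < nc \<Longrightarrow> ((\<lambda>h. X h $$ (i,j)) \<longlongrightarrow> L $$ (i,j)) F"
  using assms unfolding mat_tendsto_def by blast+

lemma mat_tendsto_const: "L \<in> carrier_mat nr nc \<Longrightarrow> mat_tendsto nr nc (\<lambda>_. L) L F"
  by (intro mat_tendstoI) auto

lemma mat_tendsto_smult:
  fixes L :: "'b::real_normed_field mat"
  assumes "(c \<longlongrightarrow> c0) F" "mat_tendsto nr nc X L F"
  shows "mat_tendsto nr nc (\<lambda>h. c h \<cdot>\<^sub>m X h) (c0 \<cdot>\<^sub>m L) F"
proof (rule mat_tendstoI)
  note car = mat_tendstoD(1,2)[OF assms(2)]
  fix i j assume ij: "i < nr" "j < nc"
  have "((\<lambda>h. c h * X h $$ (i,j)) \<longlongrightarrow> c0 * L $$ (i,j)) F"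
    by (intro tendsto_intros assms(1) mat_tendstoD(3)[OF assms(2)] ij)
  then show "((\<lambda>h. (c h \<cdot>\<^sub>m X h) $$ (i,j)) \<longlongrightarrow> (c0 \<cdot>\<^sub>m L) $$ (i,j)) F"
    using ij carrier_matD[OF car(1)] carrier_matD[OF car(2)] by simp
qed (use mat_tendstoD(1,2)[OF assms(2)] in auto)

lemma mat_tendsto_minus:
  fixes L :: "'b::real_normed_field mat"
  assumes "mat_tendsto nr nc X L F" "mat_tendsto nr nc Y M F"
  shows "mat_tendsto nr nc (\<lambda>h. X h - Y h) (L - M) F"
proof (rule mat_tendstoI)
  note car = mat_tendstoD(1,2)[OF assms(1)] mat_tendstoD(1,2)[OF assms(2)]
  fix i j assume ij: "i < nr" "j < nc"
  have "((\<lambda>h. X h $$ (i,j) - Y h $$ (i,j)) \<longlongrightarrow> L $$ (i,j) - M $$ (i,j)) F"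
    by (intro tendsto_intros mat_tendstoD(3)[OF assms(1)] mat_tendstoD(3)[OF assms(2)] ij)
  then show "((\<lambda>h. (X h - Y h) $$ (i,j)) \<longlongrightarrow> (L - M) $$ (i,j)) F"
    using ij carrier_matD[OF car(3)] carrier_matD[OF car(4)] by simp
qed (use mat_tendstoD(1,2)[OF assms(1)] mat_tendstoD(1,2)[OF assms(2)] in \<open>auto intro: minus_carrier_mat\<close>)

lemma mat_tendsto_uminus:
  fixes L :: "'b::real_normed_field mat"
  assumes "mat_tendsto nr nc X L F"
  shows "mat_tendsto nr nc (\<lambda>h. - X h) (- L) F"
proof (rule mat_tendstoI)
  note car = mat_tendstoD(1,2)[OF assms]
  fix i j assume ij: "i < nr" "j < nc"
  have "((\<lambda>h. - X h $$ (i,j)) \<longlongrightarrow> - L $$ (i,j)) F"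
    by (intro tendsto_intros mat_tendstoD(3)[OF assms] ij)
  then show "((\<lambda>h. (- X h) $$ (i,j)) \<longlongrightarrow> (- L) $$ (i,j)) F"
    using ij carrier_matD[OF car(1)] carrier_matD[OF car(2)] by simp
qed (use mat_tendstoD(1,2)[OF assms] in auto)

lemma mat_tendsto_mult:
  fixes L :: "'b::real_normed_field mat"
  assumes "mat_tendsto nr k X L F" "mat_tendsto k nc Y M F"
  shows "mat_tendsto nr nc (\<lambda>h. X h * Y h) (L * M) F"
proof (rule mat_tendstoI)
  note car = mat_tendstoD(1,2)[OF assms(1)] mat_tendstoD(1,2)[OF assms(2)]
  fix i j assume ij: "i < nr" "j < nc"
  have "((\<lambda>h. \<Sum>l = 0..<k. X h $$ (i,l) * Y h $$ (l,j)) \<longlongrightarrow> (\<Sum>l = 0..<k. L $$ (i,l) * M $$ (l,j))) F"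
    by (intro tendsto_intros mat_tendstoD(3)[OF assms(1)] mat_tendstoD(3)[OF assms(2)] ij) auto
  then show "((\<lambda>h. (X h * Y h) $$ (i,j)) \<longlongrightarrow> (L * M) $$ (i,j)) F"
    using ij carrier_matD[OF car(1)] carrier_matD[OF car(2)] carrier_matD[OF car(3)] carrier_matD[OF car(4)]
    by (simp add: scalar_prod_def)
qed (use mat_tendstoD(1,2)[OF assms(1)] mat_tendstoD(1,2)[OF assms(2)] in \<open>auto intro: mult_carrier_mat\<close>)

lemma mat_tendsto_four_block:
  assumes "mat_tendsto n1 m1 X11 L11 F" "mat_tendsto n1 m2 X12 L12 F"
    and "mat_tendsto n2 m1 X21 L21 F" "mat_tendsto n2 m2 X22 L22 F"
  shows "mat_tendsto (n1 + n2) (m1 + m2)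
    (\<lambda>h. four_block_mat (X11 h) (X12 h) (X21 h) (X22 h)) (four_block_mat L11 L12 L21 L22) F"
proof (rule mat_tendstoI)
  note d = carrier_matD[OF mat_tendstoD(1)[OF assms(1)]] carrier_matD[OF mat_tendstoD(2)[OF assms(1)]]
    carrier_matD[OF mat_tendstoD(1)[OF assms(4)]] carrier_matD[OF mat_tendstoD(2)[OF assms(4)]]
  fix i j assume ij: "i < n1 + n2" "j < m1 + m2"
  then show "((\<lambda>h. four_block_mat (X11 h) (X12 h) (X21 h) (X22 h) $$ (i,j))
      \<longlongrightarrow> four_block_mat L11 L12 L21 L22 $$ (i,j)) F"
    by (auto simp: d intro!: mat_tendstoD(3)[OF assms(1)] mat_tendstoD(3)[OF assms(2)]
          mat_tendstoD(3)[OF assms(3)] mat_tendstoD(3)[OF assms(4)])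
qed (use mat_tendstoD(1,2)[OF assms(1)] mat_tendstoD(1,2)[OF assms(4)] in auto)

lemma mat_tendsto_of_real:
  assumes "mat_tendsto nr nc X L F"
  shows "mat_tendsto nr nc (\<lambda>h. map_mat complex_of_real (X h)) (map_mat complex_of_real L) F"
proof (rule mat_tendstoI)
  note car = mat_tendstoD(1,2)[OF assms]
  fix i j assume ij: "i < nr" "j < nc"
  then show "((\<lambda>h. map_mat complex_of_real (X h) $$ (i,j)) \<longlongrightarrow> map_mat complex_of_real L $$ (i,j)) F"
    using carrier_matD[OF car(1)] carrier_matD[OF car(2)] tendsto_of_real[OF mat_tendstoD(3)[OF assms ij]]
    by simp
qed (use mat_tendstoD(1,2)[OF assms] in auto)

lemma det_tendsto:
  fixes L :: "'b::real_normed_field mat"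
  assumes "mat_tendsto n n X L F"
  shows "((\<lambda>h. det (X h)) \<longlongrightarrow> det L) F"
  unfolding det_def'[OF mat_tendstoD(1)[OF assms]] det_def'[OF mat_tendstoD(2)[OF assms]]
proof (intro tendsto_sum tendsto_mult tendsto_const tendsto_prod)
  fix \<pi> i assume "\<pi> \<in> {\<pi>. \<pi> permutes {0..<n}}" "i \<in> {0..<n}"
  then have "i < n" "\<pi> i < n" using permutes_in_image[of \<pi> "{0..<n}" i] by auto
  then show "((\<lambda>h. X h $$ (i, \<pi> i)) \<longlongrightarrow> L $$ (i, \<pi> i)) F" by (rule mat_tendstoD(3)[OF assms])
qed

section \<open>Characteristic polynomials of slow-fast block matrices\<close>

lemma poly_char_poly:
  fixes X :: "'a::comm_ring_1 mat"
  assumes "X \<in> carrier_mat n n"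
  shows "poly (char_poly X) z = det (z \<cdot>\<^sub>m 1\<^sub>m n - X)"
  unfolding char_poly_def
  by (rule poly_det_cong[of _ n], insert assms, auto simp: char_poly_matrix_def)

text \<open>This extracts the factor \<open>h ^ N\<close> when a characteristic polynomial is evaluated at \<open>1 + h s\<close>.\<close>
lemma det_scale_first_columns:
  fixes c :: "'a::idom"
  assumes "Y \<in> carrier_mat N p" and "P \<in> carrier_mat N N" "Q \<in> carrier_mat p N" "U \<in> carrier_mat p p"
  shows "det (four_block_mat (c \<cdot>\<^sub>m P) Y (c \<cdot>\<^sub>m Q) U) = c ^ N * det (four_block_mat P Y Q U)"
    (is "det ?L = _ * det ?W")
proof -
  let ?T = "four_block_mat (c \<cdot>\<^sub>m 1\<^sub>m N) (0\<^sub>m N p) (0\<^sub>m p N) (1\<^sub>m p)"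
  have 1: "P * (c \<cdot>\<^sub>m 1\<^sub>m N) + Y * 0\<^sub>m p N = c \<cdot>\<^sub>m P" "Q * (c \<cdot>\<^sub>m 1\<^sub>m N) + U * 0\<^sub>m p N = c \<cdot>\<^sub>m Q"
    using assms by (auto simp: mult_smult_distrib[of _ N N] mult_smult_distrib[of _ p N])
  have "?W * ?T = ?L"
  proof (subst mult_four_block_mat[of _ N N _ p _ p _ _ N _ p])
    show "four_block_mat (P * (c \<cdot>\<^sub>m 1\<^sub>m N) + Y * 0\<^sub>m p N) (P * 0\<^sub>m N p + Y * 1\<^sub>m p)
      (Q * (c \<cdot>\<^sub>m 1\<^sub>m N) + U * 0\<^sub>m p N) (Q * 0\<^sub>m N p + U * 1\<^sub>m p) = ?L"
      unfolding 1 using assms by (intro cong_four_block_mat refl) auto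
  qed (use assms in auto)
  moreover have "det (?W * ?T) = det ?W * det ?T"
    using assms by (intro det_mult[of _ "N + p"]) auto
  moreover have "det ?T = c ^ N"
    by (subst det_four_block_mat_upper_right_zero[of _ N _ p]) (auto simp: det_smult)
  ultimately show ?thesis by simp
qed

context
  fixes N p :: nat and Y R :: "complex mat"
  assumes Y: "Y \<in> carrier_mat N p" and R: "R \<in> carrier_mat p N"
begin

text \<open>Adding the last block column times \<open>R\<close> to the first one. It cancels the term \<open>Y R\<close>, which does
  not become small, against the off-diagonal block, and leaves a first block column that vanishes
  as both \<open>z - 1\<close> and \<open>V\<close> do.\<close>
lemma char_poly_eval_sheared:
  assumes V: "V \<in> carrier_mat N N"
  shows "poly (char_poly (four_block_mat (1\<^sub>m N + V - Y * R) Y R (0\<^sub>m p p))) z =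
    det (four_block_mat ((z - 1) \<cdot>\<^sub>m 1\<^sub>m N - V) (- Y) ((z - 1) \<cdot>\<^sub>m R) (z \<cdot>\<^sub>m 1\<^sub>m p))"
    (is "poly (char_poly ?X) z = det ?W")
proof -
  let ?T = "four_block_mat (1\<^sub>m N) (0\<^sub>m N p) R (1\<^sub>m p)"
  let ?Z = "four_block_mat (z \<cdot>\<^sub>m 1\<^sub>m N - (1\<^sub>m N + V - Y * R)) (- Y) (- R) (z \<cdot>\<^sub>m 1\<^sub>m p)"
  have X: "?X \<in> carrier_mat (N + p) (N + p)" using Y R V by auto
  have Z: "z \<cdot>\<^sub>m 1\<^sub>m (N + p) - ?X = ?Z"
    using Y R V by (intro eq_matI) auto
  have 1: "(z \<cdot>\<^sub>m 1\<^sub>m N - (1\<^sub>m N + V - Y * R)) * 1\<^sub>m N + - Y * R = (z - 1) \<cdot>\<^sub>m 1\<^sub>m N - V"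
    using Y R V by (intro eq_matI) (auto simp: algebra_simps uminus_mult_left_mat)
  have 2: "- R * 1\<^sub>m N + z \<cdot>\<^sub>m 1\<^sub>m p * R = (z - 1) \<cdot>\<^sub>m R"
    using R by (subst mult_smult_assoc_mat[of _ p p], auto, intro eq_matI, auto simp: algebra_simps)
  have "?Z * ?T = ?W"
  proof (subst mult_four_block_mat[of _ N N _ p _ p _ _ N _ p])
    show "four_block_mat
     ((z \<cdot>\<^sub>m 1\<^sub>m N - (1\<^sub>m N + V - Y * R)) * 1\<^sub>m N + - Y * R)
     ((z \<cdot>\<^sub>m 1\<^sub>m N - (1\<^sub>m N + V - Y * R)) * 0\<^sub>m N p + - Y * 1\<^sub>m p)
     (- R * 1\<^sub>m N + z \<cdot>\<^sub>m 1\<^sub>m p * R) (- R * 0\<^sub>m N p + z \<cdot>\<^sub>m 1\<^sub>m p * 1\<^sub>m p) = ?W"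
      unfolding 1 2 using Y R V by (intro cong_four_block_mat refl) auto
  qed (use Y R V in auto)
  moreover have "det ?T = 1"
    using R by (subst det_four_block_mat_upper_right_zero[of _ N _ p]) auto
  moreover have "det (?Z * ?T) = det ?Z * det ?T"
    using Y R V by (intro det_mult[of _ "N + p"]) auto
  ultimately show ?thesis unfolding poly_char_poly[OF X] Z by simp
qed

text \<open>Subtracting \<open>R\<close> times the first block row from the last makes the matrix triangular.\<close>
lemma det_fast_block:
  "det (four_block_mat (a \<cdot>\<^sub>m 1\<^sub>m N) (- Y) (a \<cdot>\<^sub>m R) (z \<cdot>\<^sub>m 1\<^sub>m p)) =
    a ^ N * det (z \<cdot>\<^sub>m 1\<^sub>m p + R * Y)" (is "det ?W = _")
proof -
  let ?T = "four_block_mat (1\<^sub>m N) (0\<^sub>m N p) (- R) (1\<^sub>m p)"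
  let ?D = "four_block_mat (a \<cdot>\<^sub>m 1\<^sub>m N) (- Y) (0\<^sub>m p N) (z \<cdot>\<^sub>m 1\<^sub>m p + R * Y)"
  have 1: "- R * (a \<cdot>\<^sub>m 1\<^sub>m N) + 1\<^sub>m p * (a \<cdot>\<^sub>m R) = 0\<^sub>m p N"
    using R by (simp add: mult_smult_distrib[of _ p N], intro eq_matI, auto)
  have 2: "- R * - Y + 1\<^sub>m p * (z \<cdot>\<^sub>m 1\<^sub>m p) = z \<cdot>\<^sub>m 1\<^sub>m p + R * Y"
    using Y R by (intro eq_matI) (auto simp: uminus_mult_left_mat uminus_mult_right_mat)
  have "?T * ?W = ?D"
  proof (subst mult_four_block_mat[of _ N N _ p _ p _ _ N _ p])
    show "four_block_mat (1\<^sub>m N * (a \<cdot>\<^sub>m 1\<^sub>m N) + 0\<^sub>m N p * (a \<cdot>\<^sub>m R))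
     (1\<^sub>m N * - Y + 0\<^sub>m N p * (z \<cdot>\<^sub>m 1\<^sub>m p)) (- R * (a \<cdot>\<^sub>m 1\<^sub>m N) + 1\<^sub>m p * (a \<cdot>\<^sub>m R))
     (- R * - Y + 1\<^sub>m p * (z \<cdot>\<^sub>m 1\<^sub>m p)) = ?D"
      unfolding 1 2 using Y R by (intro cong_four_block_mat refl) auto
  qed (use Y R in auto)
  moreover have "det ?T = 1"
    using R by (subst det_four_block_mat_upper_right_zero[of _ N _ p]) auto
  moreover have "det (?T * ?W) = det ?T * det ?W"
    using Y R by (intro det_mult[of _ "N + p"]) auto
  moreover have "det ?D = det (a \<cdot>\<^sub>m 1\<^sub>m N) * det (z \<cdot>\<^sub>m 1\<^sub>m p + R * Y)"
    using Y R by (intro det_four_block_mat_lower_left_zero) auto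
  ultimately show ?thesis by (simp add: det_smult)
qed

text \<open>Adding \<open>Y\<close> times the last block row to the first turns the upper left block into
  \<open>(I + Y R) (s I - Aid)\<close>: eliminating the fast variable multiplies \<open>s\<close> by \<open>I + Y R\<close>, and this is how
  the inverse of \<open>I + Y R\<close> enters the limiting slow dynamics.\<close>
lemma det_slow_block:
  assumes Aid: "Aid \<in> carrier_mat N N"
  shows "det (four_block_mat (s \<cdot>\<^sub>m 1\<^sub>m N - (1\<^sub>m N + Y * R) * Aid) (- Y) (s \<cdot>\<^sub>m R) (1\<^sub>m p)) =
    det (1\<^sub>m N + Y * R) * poly (char_poly Aid) s" (is "det ?W = _")
proof -
  let ?E = "1\<^sub>m N + Y * R"
  let ?T = "four_block_mat (1\<^sub>m N) Y (0\<^sub>m p N) (1\<^sub>m p)"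
  let ?D = "four_block_mat (?E * (s \<cdot>\<^sub>m 1\<^sub>m N - Aid)) (0\<^sub>m N p) (s \<cdot>\<^sub>m R) (1\<^sub>m p)"
  have E: "?E \<in> carrier_mat N N" using Y R by auto
  have *: "?E * (s \<cdot>\<^sub>m 1\<^sub>m N - Aid) = s \<cdot>\<^sub>m ?E - ?E * Aid"
    using mult_minus_distrib_mat[OF E _ Aid, of "s \<cdot>\<^sub>m 1\<^sub>m N"] E
    by (simp add: mult_smult_distrib[OF E one_carrier_mat] right_mult_one_mat[OF E])
  have 1: "1\<^sub>m N * (s \<cdot>\<^sub>m 1\<^sub>m N - ?E * Aid) + Y * (s \<cdot>\<^sub>m R) = ?E * (s \<cdot>\<^sub>m 1\<^sub>m N - Aid)"
    unfolding * mult_smult_distrib[OF Y R]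
    using E Aid Y R by (intro eq_matI) (auto simp: algebra_simps)
  have 2: "1\<^sub>m N * - Y + Y * 1\<^sub>m p = 0\<^sub>m N p"
    using Y by (intro eq_matI) auto
  have "?T * ?W = ?D"
  proof (subst mult_four_block_mat[of _ N N _ p _ p _ _ N _ p])
    show "four_block_mat (1\<^sub>m N * (s \<cdot>\<^sub>m 1\<^sub>m N - ?E * Aid) + Y * (s \<cdot>\<^sub>m R))
     (1\<^sub>m N * - Y + Y * 1\<^sub>m p) (0\<^sub>m p N * (s \<cdot>\<^sub>m 1\<^sub>m N - ?E * Aid) + 1\<^sub>m p * (s \<cdot>\<^sub>m R))
     (0\<^sub>m p N * - Y + 1\<^sub>m p * 1\<^sub>m p) = ?D"
      unfolding 1 2 using Y R E Aid by (intro cong_four_block_mat refl) auto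
  qed (use Y R E Aid in auto)
  moreover have "det ?T = 1"
    using Y by (subst det_four_block_mat_lower_left_zero[of _ N _ p]) auto
  moreover have "det (?T * ?W) = det ?T * det ?W"
    using Y R E Aid by (intro det_mult[of _ "N + p"]) auto
  moreover have "det ?D = det (?E * (s \<cdot>\<^sub>m 1\<^sub>m N - Aid)) * det (1\<^sub>m p :: complex mat)"
    using Y R E Aid by (intro det_four_block_mat_upper_right_zero) auto
  moreover have "det (?E * (s \<cdot>\<^sub>m 1\<^sub>m N - Aid)) = det ?E * det (s \<cdot>\<^sub>m 1\<^sub>m N - Aid)"
    using E Aid by (intro det_mult[of _ N]) auto
  ultimately show ?thesis by (simp add: poly_char_poly[OF Aid])
qed

end

section \<open>Eigenvalues of slow-fast block matrices\<close>

lemma char_poly_complex_roots: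
  fixes X :: "complex mat"
  assumes "X \<in> carrier_mat n n"
  shows "size (proots (char_poly X)) = n"
    and "poly (char_poly X) z = (\<Prod>x\<in>#proots (char_poly X). z - x)"
proof -
  have monic: "degree (char_poly X) = n" "lead_coeff (char_poly X) = 1"
    using degree_monic_char_poly[OF assms] by auto
  show "size (proots (char_poly X)) = n" by (simp add: size_proots_complex monic)
  have "char_poly X = (\<Prod>x\<in>#proots (char_poly X). [:- x, 1:])"
    using complex_poly_decompose_multiset[of "char_poly X"] monic by simp
  then have "poly (char_poly X) z = poly (\<Prod>x\<in>#proots (char_poly X). [:- x, 1:]) z" by simp
  also have "\<dots> = (\<Prod>x\<in>#proots (char_poly X). z - x)"
    by (simp add: poly_prod_mset image_mset.compositionality o_def)
  finally show "poly (char_poly X) z = (\<Prod>x\<in>#proots (char_poly X). z - x)" .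
qed

lemma poly_char_poly_labelled:
  fixes X :: "complex mat"
  assumes "X \<in> carrier_mat n n" and "image_mset r (mset_set J) = proots (char_poly X)"
  shows "poly (char_poly X) z = (\<Prod>j\<in>J. z - r j)"
  unfolding char_poly_complex_roots(2)[OF assms(1)] assms(2)[symmetric]
  by (simp add: prod_unfold_prod_mset image_mset.compositionality o_def)

text \<open>The abstract form of the result. For the slow group the variable is \<open>s = (z - 1) / h\<close>; in it the
  characteristic polynomial, divided by \<open>h ^ N\<close>, has leading coefficient \<open>h ^ p\<close> and converges to
  \<open>det (I + Y0 R)\<close> times the characteristic polynomial of \<open>Aid\<close>, so \<open>N\<close> of the rescaled roots converge
  and the others may escape. For the fast group no rescaling is needed, and the factor belonging to
  the slow group, which tends to \<open>(z - 1) ^ N\<close>, is divided out. Removing exactly the roots that were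
  already labelled is what makes the two partial labellings fit together.\<close>
theorem slow_fast_eigenvalues:
  fixes V Y :: "real \<Rightarrow> complex mat" and Y0 R Aid :: "complex mat" and \<mu> \<nu> :: "nat \<Rightarrow> complex" and N p :: nat
  defines "X \<equiv> (\<lambda>h. four_block_mat (1\<^sub>m N + complex_of_real h \<cdot>\<^sub>m V h - Y h * R) (Y h) R (0\<^sub>m p p))"
  assumes R: "R \<in> carrier_mat p N" and Aid: "Aid \<in> carrier_mat N N"
    and V: "mat_tendsto N N V ((1\<^sub>m N + Y0 * R) * Aid) (at_right 0)"
    and Y: "mat_tendsto N p Y Y0 (at_right 0)"
    and E: "det (1\<^sub>m N + Y0 * R) \<noteq> 0"
    and \<mu>: "image_mset \<mu> (mset_set {1..N}) = proots (char_poly Aid)"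
    and \<nu>: "image_mset \<nu> (mset_set {1..p}) = proots (char_poly (R * Y0))"
  shows "\<exists>lam :: nat \<Rightarrow> real \<Rightarrow> complex.
    (\<forall>\<^sub>F h in at_right 0. image_mset (\<lambda>j. lam j h) (mset_set {1..N+p}) = proots (char_poly (X h))) \<and>
    (\<forall>j\<in>{1..N}. ((\<lambda>h. (lam j h - 1) / complex_of_real h) \<longlongrightarrow> \<mu> j) (at_right 0)) \<and>
    (\<forall>l\<in>{1..p}. (lam (N + l) \<longlongrightarrow> - \<nu> l) (at_right 0))"
proof -
  note Yc = mat_tendstoD(1,2)[OF Y] and Vc = mat_tendstoD(1)[OF V]
  define M where "M h = proots (char_poly (X h))" for h
  define c where "c h = complex_of_real h" for h :: real
  have h0: "(c \<longlongrightarrow> 0) (at_right 0)"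
  proof -
    have "((\<lambda>h. complex_of_real h) \<longlongrightarrow> complex_of_real 0) (at_right 0)"
      by (intro tendsto_intros)
    then show ?thesis by (simp add: c_def[abs_def])
  qed
  have hpos: "\<forall>\<^sub>F h in at_right 0. c h \<noteq> 0"
    using eventually_at_right_less[of "0::real"] by eventually_elim (simp add: c_def)
  have X: "X h \<in> carrier_mat (N + p) (N + p)" for h
    unfolding X_def using Yc(1)[of h] Vc[of h] R by auto
  have size_M: "size (M h) = N + p" for h
    unfolding M_def by (rule char_poly_complex_roots(1)[OF X])
  define W where "W h z = four_block_mat ((z - 1) \<cdot>\<^sub>m 1\<^sub>m N - c h \<cdot>\<^sub>m V h) (- Y h) ((z - 1) \<cdot>\<^sub>m R) (z \<cdot>\<^sub>m 1\<^sub>m p)" for h z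
  have char_M: "(\<Prod>x\<in>#M h. z - x) = det (W h z)" for h z
  proof -
    have "(\<Prod>x\<in>#M h. z - x) = poly (char_poly (X h)) z"
      unfolding M_def by (rule char_poly_complex_roots(2)[OF X, symmetric])
    also have "\<dots> = det (W h z)"
      unfolding X_def W_def c_def by (rule char_poly_eval_sheared) (use Yc(1)[of h] Vc[of h] R in auto)
    finally show ?thesis .
  qed

  \<comment> \<open>The slow group, seen through the variable \<open>s\<close> with \<open>z = 1 + h s\<close>.\<close>
  define slow where "slow h = image_mset (\<lambda>x. (x - 1) / c h) (M h)" for h
  have slow_limit: "((\<lambda>h. c h ^ p * (\<Prod>x\<in>#slow h. s - x)) \<longlongrightarrow>
      det (1\<^sub>m N + Y0 * R) * (\<Prod>j\<in>{1..N}. s - \<mu> j)) (at_right 0)" for s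
  proof -
    define U where "U h = four_block_mat (s \<cdot>\<^sub>m 1\<^sub>m N - V h) (- Y h) (s \<cdot>\<^sub>m R) ((1 + c h * s) \<cdot>\<^sub>m 1\<^sub>m p)" for h
    have "mat_tendsto (N + p) (N + p) U
        (four_block_mat (s \<cdot>\<^sub>m 1\<^sub>m N - (1\<^sub>m N + Y0 * R) * Aid) (- Y0) (s \<cdot>\<^sub>m R) ((1 + 0 * s) \<cdot>\<^sub>m 1\<^sub>m p))
        (at_right 0)"
      unfolding U_def
      by (intro mat_tendsto_four_block mat_tendsto_minus mat_tendsto_smult mat_tendsto_uminus
          mat_tendsto_const tendsto_intros h0 V Y R one_carrier_mat)
    then have "((\<lambda>h. det (U h)) \<longlongrightarrow> det (four_block_mat (s \<cdot>\<^sub>m 1\<^sub>m N - (1\<^sub>m N + Y0 * R) * Aid)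
        (- Y0) (s \<cdot>\<^sub>m R) ((1 + 0 * s) \<cdot>\<^sub>m 1\<^sub>m p))) (at_right 0)"
      by (rule det_tendsto)
    also have "(1 + 0 * s) \<cdot>\<^sub>m 1\<^sub>m p = (1\<^sub>m p :: complex mat)" by (intro eq_matI) auto
    also have "det (four_block_mat (s \<cdot>\<^sub>m 1\<^sub>m N - (1\<^sub>m N + Y0 * R) * Aid) (- Y0) (s \<cdot>\<^sub>m R) (1\<^sub>m p))
        = det (1\<^sub>m N + Y0 * R) * (\<Prod>j\<in>{1..N}. s - \<mu> j)"
      unfolding det_slow_block[OF Yc(2) R Aid] poly_char_poly_labelled[OF Aid \<mu>] ..
    finally have lim: "((\<lambda>h. det (U h)) \<longlongrightarrow> det (1\<^sub>m N + Y0 * R) * (\<Prod>j\<in>{1..N}. s - \<mu> j)) (at_right 0)" .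
    have "\<forall>\<^sub>F h in at_right 0. det (U h) = c h ^ p * (\<Prod>x\<in>#slow h. s - x)"
      using hpos
    proof eventually_elim
      case (elim h)
      have "W h (1 + c h * s) = four_block_mat (c h \<cdot>\<^sub>m (s \<cdot>\<^sub>m 1\<^sub>m N - V h)) (- Y h) (c h \<cdot>\<^sub>m (s \<cdot>\<^sub>m R))
          ((1 + c h * s) \<cdot>\<^sub>m 1\<^sub>m p)"
        unfolding W_def using Vc[of h] R by (intro cong_four_block_mat eq_matI refl) (auto simp: algebra_simps)
      then have "(\<Prod>x\<in>#M h. 1 + c h * s - x) = det (four_block_mat (c h \<cdot>\<^sub>m (s \<cdot>\<^sub>m 1\<^sub>m N - V h)) (- Y h)
          (c h \<cdot>\<^sub>m (s \<cdot>\<^sub>m R)) ((1 + c h * s) \<cdot>\<^sub>m 1\<^sub>m p))"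
        unfolding char_M by simp
      also have "\<dots> = c h ^ N * det (U h)"
        unfolding U_def
        by (rule det_scale_first_columns)
          (use Vc[of h] R Yc(1)[of h] in \<open>auto intro: minus_carrier_mat\<close>)
      finally have "(\<Prod>x\<in>#M h. 1 + c h * s - x) = c h ^ N * det (U h)" .
      moreover have "(\<Prod>x\<in>#M h. 1 + c h * s - x) = c h ^ (N + p) * (\<Prod>x\<in>#slow h. s - x)"
      proof -
        have "1 + c h * s - x = c h * (s - (x - 1) / c h)" for x using elim by (simp add: field_simps)
        then have "(\<Prod>x\<in>#M h. 1 + c h * s - x) = (\<Prod>x\<in>#M h. c h * (s - (x - 1) / c h))" by presburger
        also have "\<dots> = c h ^ size (M h) * (\<Prod>x\<in>#M h. s - (x - 1) / c h)"
          by (simp add: prod_mset.distrib)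
        finally show ?thesis
          by (simp add: size_M slow_def image_mset.compositionality o_def)
      qed
      ultimately show ?case using elim by (simp add: power_add)
    qed
    with lim show ?thesis by (rule Lim_transform_eventually)
  qed
  obtain \<sigma> where \<sigma>_mem: "\<forall>\<^sub>F h in at_right 0. image_mset (\<lambda>j. \<sigma> j h) (mset_set {1..N}) \<subseteq># slow h"
    and \<sigma>_lim: "\<And>j. j \<in> {1..N} \<Longrightarrow> (\<sigma> j \<longlongrightarrow> \<mu> j) (at_right 0)"
    using roots_converge[of "{1..N}" slow "N + p" "at_right 0", OF _ _ E, of "{}" "\<lambda>h. c h ^ p" \<mu>] slow_limit
    by (auto simp: slow_def size_M)

  \<comment> \<open>Back in the original variable, the labelled slow roots are removed; those left over form the
    fast group.\<close>
  define \<rho> where "\<rho> j h = 1 + c h * \<sigma> j h" for j h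
  define M' where "M' h = M h - image_mset (\<lambda>j. \<rho> j h) (mset_set {1..N})" for h
  have \<rho>_mem: "\<forall>\<^sub>F h in at_right 0. image_mset (\<lambda>j. \<rho> j h) (mset_set {1..N}) \<subseteq># M h"
    using \<sigma>_mem hpos
  proof eventually_elim
    case (elim h)
    from image_mset_subseteq_mono[OF elim(1), of "\<lambda>x. 1 + c h * x"] elim(2)
    show ?case by (simp add: slow_def \<rho>_def image_mset.compositionality o_def)
  qed
  have \<rho>_lim: "(\<rho> j \<longlongrightarrow> 1) (at_right 0)" if "j \<in> {1..N}" for j
    unfolding \<rho>_def using tendsto_add[OF tendsto_const[of 1] tendsto_mult[OF h0 \<sigma>_lim[OF that]]] by simp
  have fast_limit: "((\<lambda>h. 1 * (\<Prod>x\<in>#M' h. z - x)) \<longlongrightarrow> 1 * (\<Prod>l\<in>{1..p}. z - - \<nu> l)) (at_right 0)"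
    if z: "z \<notin> {1}" for z
  proof -
    have "mat_tendsto (N + p) (N + p) (\<lambda>h. W h z) (four_block_mat ((z - 1) \<cdot>\<^sub>m 1\<^sub>m N - 0 \<cdot>\<^sub>m ((1\<^sub>m N + Y0 * R) * Aid))
        (- Y0) ((z - 1) \<cdot>\<^sub>m R) (z \<cdot>\<^sub>m 1\<^sub>m p)) (at_right 0)"
      unfolding W_def
      by (intro mat_tendsto_four_block mat_tendsto_minus mat_tendsto_smult mat_tendsto_uminus
          mat_tendsto_const tendsto_intros h0 V Y R one_carrier_mat)
    then have "((\<lambda>h. det (W h z)) \<longlongrightarrow> det (four_block_mat ((z - 1) \<cdot>\<^sub>m 1\<^sub>m N - 0 \<cdot>\<^sub>m ((1\<^sub>m N + Y0 * R) * Aid))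
        (- Y0) ((z - 1) \<cdot>\<^sub>m R) (z \<cdot>\<^sub>m 1\<^sub>m p))) (at_right 0)"
      by (rule det_tendsto)
    also have "(z - 1) \<cdot>\<^sub>m 1\<^sub>m N - 0 \<cdot>\<^sub>m ((1\<^sub>m N + Y0 * R) * Aid) = (z - 1) \<cdot>\<^sub>m 1\<^sub>m N"
      using Aid Yc(2) R by (intro eq_matI) auto
    also have "det (four_block_mat ((z - 1) \<cdot>\<^sub>m 1\<^sub>m N) (- Y0) ((z - 1) \<cdot>\<^sub>m R) (z \<cdot>\<^sub>m 1\<^sub>m p))
        = (z - 1) ^ N * det (z \<cdot>\<^sub>m 1\<^sub>m p + R * Y0)"
      by (rule det_fast_block[OF Yc(2) R])
    \<comment> \<open>Up to the sign \<open>(- 1) ^ p\<close> this is the characteristic polynomial of \<open>R Y0\<close> at \<open>- z\<close>, which is why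
      the fast limits are the negated eigenvalues.\<close>
    also have "det (z \<cdot>\<^sub>m 1\<^sub>m p + R * Y0) = (\<Prod>l\<in>{1..p}. z - - \<nu> l)"
    proof -
      have RY: "R * Y0 \<in> carrier_mat p p" using R Yc(2) by auto
      have "z \<cdot>\<^sub>m 1\<^sub>m p + R * Y0 = (- 1) \<cdot>\<^sub>m ((- z) \<cdot>\<^sub>m 1\<^sub>m p - R * Y0)"
        using RY carrier_matD[OF R] carrier_matD[OF Yc(2)] by (intro eq_matI) (auto simp: algebra_simps)
      then have "det (z \<cdot>\<^sub>m 1\<^sub>m p + R * Y0) = (- 1) ^ p * det ((- z) \<cdot>\<^sub>m 1\<^sub>m p - R * Y0)"
        using carrier_matD[OF Yc(2)] by (simp add: det_smult)
      also have "det ((- z) \<cdot>\<^sub>m 1\<^sub>m p - R * Y0) = (\<Prod>l\<in>{1..p}. - z - \<nu> l)"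
        unfolding poly_char_poly[OF RY, symmetric] by (rule poly_char_poly_labelled[OF RY \<nu>])
      also have "(- 1) ^ p * (\<Prod>l\<in>{1..p}. - z - \<nu> l) = (\<Prod>l\<in>{1..p}. (- 1) * (- z - \<nu> l))"
        by (subst prod.distrib) simp
      finally show ?thesis by (simp add: algebra_simps)
    qed
    finally have W_lim: "((\<lambda>h. det (W h z)) \<longlongrightarrow> (z - 1) ^ N * (\<Prod>l\<in>{1..p}. z - - \<nu> l)) (at_right 0)" .
    have "((\<lambda>h. det (W h z) / (\<Prod>j\<in>{1..N}. z - \<rho> j h)) \<longlongrightarrow>
        ((z - 1) ^ N * (\<Prod>l\<in>{1..p}. z - - \<nu> l)) / (\<Prod>j\<in>{1..N}. z - 1)) (at_right 0)"
      using z by (intro tendsto_divide tendsto_prod tendsto_diff tendsto_const W_lim \<rho>_lim) auto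
    then have lim: "((\<lambda>h. det (W h z) / (\<Prod>j\<in>{1..N}. z - \<rho> j h)) \<longlongrightarrow> (\<Prod>l\<in>{1..p}. z - - \<nu> l)) (at_right 0)"
      using z by simp
    have "\<forall>\<^sub>F h in at_right 0. \<forall>j\<in>{1..N}. \<rho> j h \<noteq> z"
      using z by (intro eventually_ball_finite ballI tendsto_imp_eventually_ne[OF \<rho>_lim]) auto
    with \<rho>_mem have "\<forall>\<^sub>F h in at_right 0. det (W h z) / (\<Prod>j\<in>{1..N}. z - \<rho> j h) = (\<Prod>x\<in>#M' h. z - x)"
    proof eventually_elim
      case (elim h)
      have "M h = image_mset (\<lambda>j. \<rho> j h) (mset_set {1..N}) + M' h"
        using elim(1) by (simp add: M'_def)
      then have "det (W h z) = (\<Prod>j\<in>{1..N}. z - \<rho> j h) * (\<Prod>x\<in>#M' h. z - x)"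
        by (simp add: prod_unfold_prod_mset image_mset.compositionality o_def flip: char_M)
      moreover have "(\<Prod>j\<in>{1..N}. z - \<rho> j h) \<noteq> 0" using elim(2) by auto
      ultimately show ?case by simp
    qed
    with lim have "((\<lambda>h. \<Prod>x\<in>#M' h. z - x) \<longlongrightarrow> (\<Prod>l\<in>{1..p}. z - - \<nu> l)) (at_right 0)"
      by (rule Lim_transform_eventually)
    then show ?thesis by simp
  qed
  have size_M': "\<forall>\<^sub>F h in at_right 0. size (M' h) = p"
    using \<rho>_mem by eventually_elim (simp add: M'_def size_Diff_submset size_M)
  obtain \<tau> where \<tau>_mem: "\<forall>\<^sub>F h in at_right 0. image_mset (\<lambda>l. \<tau> l h) (mset_set {1..p}) \<subseteq># M' h"
    and \<tau>_lim: "\<And>l. l \<in> {1..p} \<Longrightarrow> (\<tau> l \<longlongrightarrow> - \<nu> l) (at_right 0)"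
  proof -
    have "\<forall>\<^sub>F h in at_right 0. size (M' h) \<le> p" using size_M' by eventually_elim simp
    from roots_converge[OF _ this, of "{1..p}" 1 "{1}" "\<lambda>_. 1" "\<lambda>l. - \<nu> l"] fast_limit that
    show ?thesis by auto
  qed
  define lam where "lam j = (if j \<le> N then \<rho> j else \<tau> (j - N))" for j
  have "\<forall>\<^sub>F h in at_right 0. image_mset (\<lambda>j. lam j h) (mset_set {1..N+p}) = M h"
    using \<rho>_mem \<tau>_mem size_M'
  proof eventually_elim
    case (elim h)
    have "mset_set {1..N+p} = mset_set {1..N} + image_mset (\<lambda>l. N + l) (mset_set {1..p})"
    proof -
      have "{1..N+p} = {1..N} \<union> (\<lambda>l. N + l) ` {1..p}"
        by (auto simp: image_iff)
      then show ?thesis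
        by (subst image_mset_mset_set) (auto simp: mset_set_Union)
    qed
    then have "image_mset (\<lambda>j. lam j h) (mset_set {1..N+p})
        = image_mset (\<lambda>j. lam j h) (mset_set {1..N}) + image_mset (\<lambda>l. lam (N + l) h) (mset_set {1..p})"
      by (simp add: image_mset.compositionality o_def)
    also have "image_mset (\<lambda>j. lam j h) (mset_set {1..N}) = image_mset (\<lambda>j. \<rho> j h) (mset_set {1..N})"
      by (intro image_mset_cong) (auto simp: lam_def)
    also have "image_mset (\<lambda>l. lam (N + l) h) (mset_set {1..p}) = image_mset (\<lambda>l. \<tau> l h) (mset_set {1..p})"
      by (intro image_mset_cong) (auto simp: lam_def)
    \<comment> \<open>Both sides have \<open>p\<close> elements, so the inclusion is an equality.\<close>
    also have "image_mset (\<lambda>l. \<tau> l h) (mset_set {1..p}) = M' h"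
      using elim(2,3) by (metis card_atLeastAtMost diff_Suc_1 mset_subset_size size_image_mset size_mset_set
          subset_mset.less_le less_irrefl)
    finally show ?case using elim(1) by (simp add: M'_def)
  qed
  moreover have "((\<lambda>h. (lam j h - 1) / complex_of_real h) \<longlongrightarrow> \<mu> j) (at_right 0)" if j: "j \<in> {1..N}" for j
    using \<sigma>_lim[OF j]
  proof (rule Lim_transform_eventually)
    show "\<forall>\<^sub>F h in at_right 0. \<sigma> j h = (lam j h - 1) / complex_of_real h"
      using hpos by eventually_elim (use j in \<open>simp add: lam_def \<rho>_def c_def\<close>)
  qed
  moreover have "(lam (N + l) \<longlongrightarrow> - \<nu> l) (at_right 0)" if "l \<in> {1..p}" for l
    using \<tau>_lim[OF that] that by (simp add: lam_def)
  ultimately show ?thesis unfolding M_def by blast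
qed

section \<open>The sampled exponential for a small period\<close>

lemma smult_pow_mat:
  fixes A :: "'a::comm_semiring_1 mat"
  assumes "A \<in> carrier_mat n n"
  shows "(c \<cdot>\<^sub>m A) ^\<^sub>m k = c ^ k \<cdot>\<^sub>m A ^\<^sub>m k"
proof (induction k)
  case 0
  show ?case using assms by (intro eq_matI) auto
next
  case (Suc k)
  have Ak: "A ^\<^sub>m k \<in> carrier_mat n n" using assms by simp
  have "(c \<cdot>\<^sub>m A) ^\<^sub>m Suc k = (c ^ k \<cdot>\<^sub>m A ^\<^sub>m k) * (c \<cdot>\<^sub>m A)" by (simp add: Suc)
  also have "\<dots> = c ^ Suc k \<cdot>\<^sub>m A ^\<^sub>m Suc k"
    using Ak assms by (intro eq_matI) (auto simp: scalar_prod_def sum_distrib_left mult_ac intro!: sum.cong)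
  finally show ?case .
qed

text \<open>A crude geometric bound; the factorials in the exponential series absorb it for every \<open>h\<close>.\<close>
lemma pow_mat_entry_bound:
  fixes A :: "real mat"
  assumes A: "A \<in> carrier_mat n n"
    and b: "\<And>i j. i < n \<Longrightarrow> j < n \<Longrightarrow> \<bar>A $$ (i,j)\<bar> \<le> b"
    and "i < n" "j < n"
  shows "\<bar>(A ^\<^sub>m k) $$ (i,j)\<bar> \<le> (real n * b) ^ k"
  using assms(3,4)
proof (induction k arbitrary: i j)
  case 0
  then show ?case using A by (auto simp: one_mat_def)
next
  case (Suc k)
  have "0 \<le> b" using b[OF Suc.prems] by linarith
  have Ak: "A ^\<^sub>m k \<in> carrier_mat n n" using A by simp
  have "(A ^\<^sub>m Suc k) $$ (i,j) = (\<Sum>l = 0..<n. (A ^\<^sub>m k) $$ (i,l) * A $$ (l,j))"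
    using A Ak Suc.prems by (simp add: scalar_prod_def)
  also have "\<bar>\<dots>\<bar> \<le> (\<Sum>l = 0..<n. \<bar>(A ^\<^sub>m k) $$ (i,l)\<bar> * \<bar>A $$ (l,j)\<bar>)"
    unfolding abs_mult[symmetric] by (rule sum_abs)
  also have "\<dots> \<le> (\<Sum>l = 0..<n. (real n * b) ^ k * b)"
    using Suc \<open>0 \<le> b\<close> by (intro sum_mono mult_mono b) auto
  finally show ?case by (simp add: mult_ac)
qed

context
  fixes A :: "real mat" and n i j :: nat
  assumes A: "A \<in> carrier_mat n n" and i: "i < n" and j: "j < n"
begin

text \<open>Each entry of \<open>exp (h A)\<close> is an entire power series in the scalar \<open>h\<close>, so that differentiability
  and continuity come from the theory of real power series.\<close>

lemma mat_exp_entry_power_series: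
  "mat_exp (h \<cdot>\<^sub>m A) $$ (i,j) = (\<Sum>k. (A ^\<^sub>m k) $$ (i,j) / fact k * h ^ k)"
proof -
  have "((h \<cdot>\<^sub>m A) ^\<^sub>m k) $$ (i,j) = h ^ k * (A ^\<^sub>m k) $$ (i,j)" for k
    using carrier_matD[OF pow_carrier_mat[OF A, of k]] i j by (simp add: smult_pow_mat[OF A])
  then show ?thesis using A i j by (simp add: mat_exp_def mult_ac)
qed

lemma summable_mat_exp_entry: "summable (\<lambda>k. (A ^\<^sub>m k) $$ (i,j) / fact k * h ^ k)"
proof -
  define b where "b = (\<Sum>i<n. \<Sum>j<n. \<bar>A $$ (i,j)\<bar>)"
  have b: "\<bar>A $$ (i,j)\<bar> \<le> b" if "i < n" "j < n" for i j
  proof -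
    have "\<bar>A $$ (i,j)\<bar> \<le> (\<Sum>j<n. \<bar>A $$ (i,j)\<bar>)"
      using that by (intro member_le_sum[of j "{..<n}" "\<lambda>j. \<bar>A $$ (i,j)\<bar>"]) auto
    also have "\<dots> \<le> b" unfolding b_def
      using that by (intro member_le_sum[of i "{..<n}" "\<lambda>i. \<Sum>j<n. \<bar>A $$ (i,j)\<bar>"]) (auto intro: sum_nonneg)
    finally show ?thesis .
  qed
  show ?thesis
  proof (rule summable_comparison_test)
    show "\<exists>K. \<forall>k\<ge>K. norm ((A ^\<^sub>m k) $$ (i,j) / fact k * h ^ k)
        \<le> inverse (fact k) * (real n * b * \<bar>h\<bar>) ^ k"
    proof (intro exI allI impI)
      fix k
      have "\<bar>(A ^\<^sub>m k) $$ (i,j)\<bar> * (inverse (fact k) * \<bar>h\<bar> ^ k) \<le> (real n * b) ^ k * (inverse (fact k) * \<bar>h\<bar> ^ k)"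
        using pow_mat_entry_bound[OF A b i j, of k] by (intro mult_right_mono) auto
      then show "norm ((A ^\<^sub>m k) $$ (i,j) / fact k * h ^ k) \<le> inverse (fact k) * (real n * b * \<bar>h\<bar>) ^ k"
        by (simp add: abs_mult power_abs power_mult_distrib field_simps)
    qed
    show "summable (\<lambda>k. inverse (fact k) * (real n * b * \<bar>h\<bar>) ^ k)" by (rule summable_exp)
  qed
qed

lemma mat_exp_entry_0: "mat_exp (0 \<cdot>\<^sub>m A) $$ (i,j) = 1\<^sub>m n $$ (i,j)"
  unfolding mat_exp_entry_power_series powser_zero using A by simp

lemma mat_exp_entry_deriv_0:
  "((\<lambda>h. mat_exp (h \<cdot>\<^sub>m A) $$ (i,j)) has_real_derivative A $$ (i,j)) (at 0)"
proof -
  let ?a = "\<lambda>k. (A ^\<^sub>m k) $$ (i,j) / fact k"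
  have "((\<lambda>h. \<Sum>k. ?a k * h ^ k) has_real_derivative (\<Sum>k. diffs ?a k * 0 ^ k)) (at 0)"
    by (rule termdiffs_strong_converges_everywhere[OF summable_mat_exp_entry])
  moreover have "(\<Sum>k. diffs ?a k * 0 ^ k) = A $$ (i,j)"
    unfolding powser_zero using A by (simp add: diffs_def)
  ultimately show ?thesis unfolding mat_exp_entry_power_series by simp
qed

lemma continuous_mat_exp_entry: "continuous_on S (\<lambda>h. mat_exp (h \<cdot>\<^sub>m A) $$ (i,j))"
proof -
  let ?a = "\<lambda>k. (A ^\<^sub>m k) $$ (i,j) / fact k"
  have "((\<lambda>h. \<Sum>k. ?a k * h ^ k) has_real_derivative (\<Sum>k. diffs ?a k * x ^ k)) (at x within S)" for x
    by (rule has_field_derivative_at_within,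
        rule termdiffs_strong_converges_everywhere[OF summable_mat_exp_entry])
  then show ?thesis unfolding mat_exp_entry_power_series by (rule DERIV_continuous_on)
qed

end

lemma Phi_difference_quotient:
  assumes A: "A \<in> carrier_mat n n"
  shows "mat_tendsto n n (\<lambda>h. inverse h \<cdot>\<^sub>m (\<Phi> A h - 1\<^sub>m n)) A (at_right 0)"
proof (rule mat_tendstoI)
  have Phi: "\<Phi> A h \<in> carrier_mat n n" for h using A by (simp add: \<Phi>_def mat_exp_def)
  show "inverse h \<cdot>\<^sub>m (\<Phi> A h - 1\<^sub>m n) \<in> carrier_mat n n" for h
    by (simp add: minus_carrier_mat)
  fix i j assume ij: "i < n" "j < n"
  have "((\<lambda>h. (mat_exp (h \<cdot>\<^sub>m A) $$ (i,j) - 1\<^sub>m n $$ (i,j)) / (h - 0)) \<longlongrightarrow> A $$ (i,j)) (at_right 0)"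
    using has_field_derivative_at_within[OF mat_exp_entry_deriv_0[OF A ij], of "{0<..}"]
    unfolding has_field_derivative_iff mat_exp_entry_0[OF A ij] .
  then show "((\<lambda>h. (inverse h \<cdot>\<^sub>m (\<Phi> A h - 1\<^sub>m n)) $$ (i,j)) \<longlongrightarrow> A $$ (i,j)) (at_right 0)"
    using ij carrier_matD[OF Phi] by (simp add: \<Phi>_def field_simps)
qed (rule A)

text \<open>The mean of \<open>exp (\<tau> A)\<close> over \<open>[0, h]\<close> tends to its value at \<open>0\<close>, by the fundamental theorem of
  calculus applied to each entry.\<close>
lemma Gamma_mean:
  assumes A: "A \<in> carrier_mat n n"
  shows "mat_tendsto n n (\<lambda>h. inverse h \<cdot>\<^sub>m \<Gamma> A h) (1\<^sub>m n) (at_right 0)"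
proof (rule mat_tendstoI)
  show "inverse h \<cdot>\<^sub>m \<Gamma> A h \<in> carrier_mat n n" for h using A by (simp add: \<Gamma>_def)
  fix i j assume ij: "i < n" "j < n"
  let ?f = "\<lambda>\<tau>. mat_exp (\<tau> \<cdot>\<^sub>m A) $$ (i,j)"
  have "((\<lambda>h. integral {0..h} ?f) has_real_derivative ?f 0) (at 0 within {0..1})"
    by (intro integral_has_real_derivative continuous_mat_exp_entry[OF A ij]) auto
  then have "((\<lambda>h. integral {0..h} ?f / h) \<longlongrightarrow> 1\<^sub>m n $$ (i,j)) (at_right 0)"
    unfolding has_field_derivative_iff mat_exp_entry_0[OF A ij] by (simp add: at_within_Icc_at_right)
  then show "((\<lambda>h. (inverse h \<cdot>\<^sub>m \<Gamma> A h) $$ (i,j)) \<longlongrightarrow> 1\<^sub>m n $$ (i,j)) (at_right 0)"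
    using ij A by (simp add: \<Gamma>_def field_simps)
qed simp

section \<open>The sampled PID loop\<close>

lemma mat_inv_right:
  assumes "invertible_mat X" and X: "X \<in> carrier_mat n n"
  shows "X * mat_inv X = 1\<^sub>m n" and "mat_inv X \<in> carrier_mat n n"
proof -
  obtain Z where Z: "X * Z = 1\<^sub>m (dim_row X)" "Z * X = 1\<^sub>m (dim_row Z)"
    using assms(1) unfolding invertible_mat_def inverts_mat_def by blast
  have dims: "dim_col Z = n" "dim_row Z = n"
    using arg_cong[OF Z(1), of dim_col] arg_cong[OF Z(2), of dim_col] X by auto
  then have "Z \<in> carrier_mat n n" by auto
  with Z dims X have "X \<in> Units (ring_mat TYPE(real) n ())"
    unfolding Units_def ring_mat_simps by auto
  then obtain W where "mat_inverse X = Some W"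
    using mat_inverse(1)[OF X] by fastforce
  then show "X * mat_inv X = 1\<^sub>m n" "mat_inv X \<in> carrier_mat n n"
    using mat_inverse(2)[OF X] by (auto simp: mat_inv_def)
qed

context
  fixes n m p :: nat and A B C KP KI KD :: "real mat"
  assumes A: "A \<in> carrier_mat n n" and B: "B \<in> carrier_mat n m" and C: "C \<in> carrier_mat p n"
    and KP: "KP \<in> carrier_mat m p" and KI: "KI \<in> carrier_mat m p" and KD: "KD \<in> carrier_mat m p"
begin

text \<open>The ingredients \<open>V\<close>, \<open>Y\<close>, \<open>R\<close> of the general slow-fast form, where \<open>G\<close> stands for \<open>\<Gamma>\<^sub>h / h\<close> and
  \<open>F\<close> for \<open>(\<Phi>\<^sub>h - I) / h\<close>. The limiting values are \<open>G = I\<close> and \<open>F = A\<close>.\<close>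

definition slow_rate :: "real mat \<Rightarrow> real mat \<Rightarrow> real mat" where
  "slow_rate G F = four_block_mat (F - G * B * KP * C) (- (G * B * KI)) C (0\<^sub>m p p)"

definition derivative_input :: "real mat \<Rightarrow> real mat" where
  "derivative_input G = G * B * KD @\<^sub>r 0\<^sub>m p p"

definition output_row :: "real mat" where
  "output_row = four_block_mat C (0\<^sub>m p p) (0\<^sub>m 0 n) (0\<^sub>m 0 p)"

lemma output_row_carrier: "output_row \<in> carrier_mat p (n + p)"
  using four_block_carrier_mat[OF C, of "0\<^sub>m 0 p" 0 p] by (simp add: output_row_def)

lemma derivative_input_output_row:
  assumes G: "G \<in> carrier_mat n n"
  shows "derivative_input G * output_row =
    four_block_mat (G * B * KD * C) (0\<^sub>m n p) (0\<^sub>m p n) (0\<^sub>m p p)"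
proof -
  have GBK: "G * B * KD \<in> carrier_mat n p" using G B KD by auto
  have "derivative_input G * output_row =
      four_block_mat (G * B * KD) (0\<^sub>m n 0) (0\<^sub>m p p) (0\<^sub>m p 0) * four_block_mat C (0\<^sub>m p p) (0\<^sub>m 0 n) (0\<^sub>m 0 p)"
    using G unfolding derivative_input_def output_row_def append_rows_def by simp
  also have "\<dots> = four_block_mat (G * B * KD * C + 0\<^sub>m n 0 * 0\<^sub>m 0 n) (G * B * KD * 0\<^sub>m p p + 0\<^sub>m n 0 * 0\<^sub>m 0 p)
      (0\<^sub>m p p * C + 0\<^sub>m p 0 * 0\<^sub>m 0 n) (0\<^sub>m p p * 0\<^sub>m p p + 0\<^sub>m p 0 * 0\<^sub>m 0 p)"
    by (rule mult_four_block_mat) (use GBK C in auto)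
  also have "\<dots> = four_block_mat (G * B * KD * C) (0\<^sub>m n p) (0\<^sub>m p n) (0\<^sub>m p p)"
    using GBK C right_mult_zero_mat[OF GBK] by (intro cong_four_block_mat) auto
  finally show ?thesis .
qed

lemma output_row_derivative_input: "output_row * derivative_input (1\<^sub>m n) = C * B * KD"
proof -
  have BK: "B * KD \<in> carrier_mat n p" using B KD by auto
  have "output_row * derivative_input (1\<^sub>m n) =
      four_block_mat C (0\<^sub>m p p) (0\<^sub>m 0 n) (0\<^sub>m 0 p) * four_block_mat (B * KD) (0\<^sub>m n 0) (0\<^sub>m p p) (0\<^sub>m p 0)"
    using BK B unfolding derivative_input_def output_row_def append_rows_def by simp
  also have "\<dots> = four_block_mat (C * (B * KD) + 0\<^sub>m p p * 0\<^sub>m p p) (C * 0\<^sub>m n 0 + 0\<^sub>m p p * 0\<^sub>m p 0)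
      (0\<^sub>m 0 n * (B * KD) + 0\<^sub>m 0 p * 0\<^sub>m p p) (0\<^sub>m 0 n * 0\<^sub>m n 0 + 0\<^sub>m 0 p * 0\<^sub>m p 0)"
    by (rule mult_four_block_mat) (use BK C in auto)
  also have "\<dots> = C * (B * KD)"
    using BK C by (intro eq_matI) auto
  finally show ?thesis using assoc_mult_mat[OF C B KD] by simp
qed

text \<open>In the PID loop the matrix \<open>I + Y R\<close> is \<open>E\<close> bordered by an identity: the integrator states are
  not affected by the derivative action.\<close>

lemma E_block:
  "1\<^sub>m (n + p) + derivative_input (1\<^sub>m n) * output_row =
    four_block_mat (E_mat A B C KD) (0\<^sub>m n p) (0\<^sub>m p n) (1\<^sub>m p)"
proof -
  have "1\<^sub>m n * B * KD * C = B * KD * C" using B by simp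
  then show ?thesis
    unfolding derivative_input_output_row[OF one_carrier_mat] E_mat_def
    using A B KD C by (intro eq_matI) auto
qed

text \<open>The derivative gain \<open>h\<^sup>-\<^sup>1 K\<^sub>D\<close> in the upper left block of the lifted matrix contributes
  \<open>- G B K\<^sub>D C\<close>, which does not vanish as \<open>h\<close> tends to \<open>0\<close>; it is exactly the term \<open>- Y R\<close>, and what
  remains is \<open>O(h)\<close> away from the identity.\<close>
lemma A_lift_sheared:
  assumes "h \<noteq> 0"
  defines "G \<equiv> inverse h \<cdot>\<^sub>m \<Gamma> A h" and "F \<equiv> inverse h \<cdot>\<^sub>m (\<Phi> A h - 1\<^sub>m n)"
  shows "A_lift A B C KP KI KD h =
    four_block_mat (1\<^sub>m (n + p) + h \<cdot>\<^sub>m slow_rate G F - derivative_input G * output_row)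
      (derivative_input G) output_row (0\<^sub>m p p)"
proof -
  have Phi: "\<Phi> A h \<in> carrier_mat n n" and Gam: "\<Gamma> A h \<in> carrier_mat n n"
    using A by (simp_all add: \<Phi>_def mat_exp_def \<Gamma>_def)
  then have G: "G \<in> carrier_mat n n" and F: "F \<in> carrier_mat n n"
    by (auto simp: G_def F_def minus_carrier_mat)
  have Gam_G: "\<Gamma> A h = h \<cdot>\<^sub>m G" and Phi_F: "\<Phi> A h = 1\<^sub>m n + h \<cdot>\<^sub>m F"
    using assms(1) Gam Phi by (auto simp: G_def F_def field_simps intro!: eq_matI)
  have GB: "G * B \<in> carrier_mat n m" using G B by auto
  have GBK: "G * B * K \<in> carrier_mat n p" if "K \<in> carrier_mat m p" for K using GB that by auto
  have scale: "\<Gamma> A h * B * K = h \<cdot>\<^sub>m (G * B * K)" if "K \<in> carrier_mat m p" for K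
    unfolding Gam_G using G B GB that by (simp add: mult_smult_assoc_mat[of _ n n] mult_smult_assoc_mat[of _ n m])
  have "G * B * (KP + inverse h \<cdot>\<^sub>m KD) = G * B * KP + inverse h \<cdot>\<^sub>m (G * B * KD)"
    using GB KP KD by (subst mult_add_distrib_mat[of _ n m _ p]) (auto simp: mult_smult_distrib[of _ n m])
  then have "\<Gamma> A h * B * (KP + inverse h \<cdot>\<^sub>m KD) = h \<cdot>\<^sub>m (G * B * KP) + G * B * KD"
    using scale[of "KP + inverse h \<cdot>\<^sub>m KD"] KP KD GBK[OF KP] GBK[OF KD] assms(1)
    by (auto simp: field_simps intro!: eq_matI)
  then have gain: "\<Gamma> A h * B * (KP + inverse h \<cdot>\<^sub>m KD) * C = h \<cdot>\<^sub>m (G * B * KP * C) + G * B * KD * C"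
    using GBK[OF KP] GBK[OF KD] C
    by (simp add: add_mult_distrib_mat[of _ n p] mult_smult_assoc_mat[of _ n p])
  have input: "inverse h \<cdot>\<^sub>m (\<Gamma> A h * B * KD) = G * B * KD"
    unfolding scale[OF KD] using assms(1) by (auto intro!: eq_matI)
  have "four_block_mat (\<Phi> A h - \<Gamma> A h * B * (KP + inverse h \<cdot>\<^sub>m KD) * C) (- (\<Gamma> A h * B * KI)) (h \<cdot>\<^sub>m C) (1\<^sub>m p)
      = 1\<^sub>m (n + p) + h \<cdot>\<^sub>m slow_rate G F - derivative_input G * output_row"
    unfolding gain scale[OF KI] Phi_F slow_rate_def derivative_input_output_row[OF G]
    using C F carrier_matD[OF G] carrier_matD[OF KP] carrier_matD[OF KD] carrier_matD[OF KI]
    by (intro eq_matI) (auto simp: algebra_simps)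
  then show ?thesis
    using A C unfolding A_lift_def Let_def input by (simp add: derivative_input_def output_row_def)
qed

text \<open>At \<open>h = 0\<close> the slow rate is the ideal closed-loop matrix before multiplication by the inverse of
  \<open>E\<close>.\<close>

lemma slow_rate_A_id:
  assumes "invertible_mat (E_mat A B C KD)"
  shows "slow_rate (1\<^sub>m n) A =
    (1\<^sub>m (n + p) + derivative_input (1\<^sub>m n) * output_row) * A_id A B C KP KI KD"
    and "A_id A B C KP KI KD \<in> carrier_mat (n + p) (n + p)"
    and "det (1\<^sub>m (n + p) + derivative_input (1\<^sub>m n) * output_row) \<noteq> 0"
proof -
  define E where "E = E_mat A B C KD"
  define Ei where "Ei = mat_inv E"
  have E: "E \<in> carrier_mat n n" unfolding E_def E_mat_def using A B C KD by auto
  note Ei = mat_inv_right[OF assms[folded E_def] E, folded Ei_def]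
  have APC: "A - B * KP * C \<in> carrier_mat n n" and BK: "B * KI \<in> carrier_mat n p"
    using B KP C KI by (auto intro: minus_carrier_mat)
  have EiA: "Ei * (A - B * KP * C) \<in> carrier_mat n n" and EiBK: "Ei * B * KI \<in> carrier_mat n p"
    using mult_carrier_mat[OF Ei(2) APC] mult_carrier_mat[OF mult_carrier_mat[OF Ei(2) B] KI] by simp_all
  have A_id: "A_id A B C KP KI KD = four_block_mat (Ei * (A - B * KP * C)) (- (Ei * B * KI)) C (0\<^sub>m p p)"
    unfolding A_id_def Let_def E_def Ei_def using C by simp
  then show "A_id A B C KP KI KD \<in> carrier_mat (n + p) (n + p)"
    using EiA by simp
  have 1: "E * (Ei * (A - B * KP * C)) = A - B * KP * C"
    using assoc_mult_mat[OF E Ei(2) APC] Ei(1) left_mult_one_mat[OF APC] by simp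
  have "Ei * B * KI = Ei * (B * KI)" by (rule assoc_mult_mat[OF Ei(2) B KI])
  moreover have "E * (Ei * (B * KI)) = B * KI"
    using assoc_mult_mat[OF E Ei(2) BK] Ei(1) left_mult_one_mat[OF BK] by simp
  ultimately have 2: "E * - (Ei * B * KI) = - (B * KI)"
    using E Ei(2) BK by (simp add: uminus_mult_right_mat[of E])
  have "four_block_mat E (0\<^sub>m n p) (0\<^sub>m p n) (1\<^sub>m p) * A_id A B C KP KI KD =
      four_block_mat (E * (Ei * (A - B * KP * C)) + 0\<^sub>m n p * C) (E * - (Ei * B * KI) + 0\<^sub>m n p * 0\<^sub>m p p)
        (0\<^sub>m p n * (Ei * (A - B * KP * C)) + 1\<^sub>m p * C) (0\<^sub>m p n * - (Ei * B * KI) + 1\<^sub>m p * 0\<^sub>m p p)"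
    unfolding A_id
    by (rule mult_four_block_mat[OF E zero_carrier_mat zero_carrier_mat one_carrier_mat
          EiA uminus_carrier_mat[OF EiBK] C zero_carrier_mat])
  also have "\<dots> = slow_rate (1\<^sub>m n) A"
    unfolding 1 2 slow_rate_def left_mult_one_mat[OF B]
      left_mult_zero_mat[OF C] left_mult_zero_mat[OF EiA] left_mult_zero_mat[OF uminus_carrier_mat[OF EiBK]]
      left_mult_zero_mat[OF zero_carrier_mat] right_mult_zero_mat[OF one_carrier_mat] left_mult_one_mat[OF C]
    using BK C by (simp add: right_add_zero_mat[OF APC])
  finally show "slow_rate (1\<^sub>m n) A =
    (1\<^sub>m (n + p) + derivative_input (1\<^sub>m n) * output_row) * A_id A B C KP KI KD"
    unfolding E_block E_def by simp
  have "det E * det Ei = 1" using det_mult[OF E Ei(2)] Ei(1) by simp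
  then have "det E \<noteq> 0" by auto
  then show "det (1\<^sub>m (n + p) + derivative_input (1\<^sub>m n) * output_row) \<noteq> 0"
    unfolding E_block E_def[symmetric]
    using E by (subst det_four_block_mat_upper_right_zero[of _ n _ p]) auto
qed

text \<open>The eigenvalue statement with the asymptotics of the slow group written as the limit of a
  quotient, which is how the general result delivers it.\<close>

theorem pid_eigenvalues:
  fixes \<mu> \<nu> :: "nat \<Rightarrow> complex"
  assumes inv: "invertible_mat (E_mat A B C KD)"
    and \<mu>: "image_mset \<mu> (mset_set {1..n+p}) = eigenvalues_mset (A_id A B C KP KI KD)"
    and \<nu>: "image_mset \<nu> (mset_set {1..p}) = eigenvalues_mset (C * B * KD)"
  shows "\<exists>lam :: nat \<Rightarrow> real \<Rightarrow> complex.
    (\<forall>\<^sub>F h in at_right 0.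
       image_mset (\<lambda>j. lam j h) (mset_set {1..n+p+p}) = eigenvalues_mset (A_lift A B C KP KI KD h)) \<and>
    (\<forall>j\<in>{1..n+p}. ((\<lambda>h. (lam j h - 1) / complex_of_real h) \<longlongrightarrow> \<mu> j) (at_right 0)) \<and>
    (\<forall>l\<in>{1..p}. (lam (n + p + l) \<longlongrightarrow> - \<nu> l) (at_right 0))"
proof -
  define G where "G h = inverse h \<cdot>\<^sub>m \<Gamma> A h" for h
  define F where "F h = inverse h \<cdot>\<^sub>m (\<Phi> A h - 1\<^sub>m n)" for h
  let ?c = "map_mat complex_of_real"
  have G: "mat_tendsto n n G (1\<^sub>m n) (at_right 0)"
    unfolding G_def by (rule Gamma_mean[OF A])
  have F: "mat_tendsto n n F A (at_right 0)"
    unfolding F_def by (rule Phi_difference_quotient[OF A])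
  have V: "mat_tendsto (n + p) (n + p) (\<lambda>h. slow_rate (G h) (F h)) (slow_rate (1\<^sub>m n) A) (at_right 0)"
    unfolding slow_rate_def
    by (intro mat_tendsto_four_block mat_tendsto_minus mat_tendsto_uminus
        mat_tendsto_mult[of n p] mat_tendsto_mult[of n m] mat_tendsto_mult[of n n]
        mat_tendsto_const F G B C KP KI zero_carrier_mat)
  have Y: "mat_tendsto (n + p) p (\<lambda>h. derivative_input (G h)) (derivative_input (1\<^sub>m n)) (at_right 0)"
  proof -
    have "derivative_input L = four_block_mat (L * B * KD) (0\<^sub>m n 0) (0\<^sub>m p p) (0\<^sub>m p 0)"
      if "L \<in> carrier_mat n n" for L
      using that by (simp add: derivative_input_def append_rows_def)
    moreover have "mat_tendsto (n + p) (p + 0) (\<lambda>h. four_block_mat (G h * B * KD) (0\<^sub>m n 0) (0\<^sub>m p p) (0\<^sub>m p 0))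
        (four_block_mat (1\<^sub>m n * B * KD) (0\<^sub>m n 0) (0\<^sub>m p p) (0\<^sub>m p 0)) (at_right 0)"
      by (intro mat_tendsto_four_block mat_tendsto_mult[of n m] mat_tendsto_mult[of n n]
          mat_tendsto_const G B KD zero_carrier_mat)
    ultimately show ?thesis using mat_tendstoD(1)[OF G] by simp
  qed
  note Rc = output_row_carrier
  note Yc = mat_tendstoD(1,2)[OF Y] and Vc = mat_tendstoD(1,2)[OF V]
  have E_complex: "?c (1\<^sub>m (n + p) + derivative_input (1\<^sub>m n) * output_row)
      = 1\<^sub>m (n + p) + ?c (derivative_input (1\<^sub>m n)) * ?c output_row"
    unfolding of_real_hom.mat_hom_mult[OF Yc(2) Rc, symmetric]
    using carrier_matD[OF Yc(2)] carrier_matD[OF Rc] by (intro eq_matI) auto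
  have E_carrier: "1\<^sub>m (n + p) + derivative_input (1\<^sub>m n) * output_row \<in> carrier_mat (n + p) (n + p)"
    using Yc(2) Rc by (intro add_carrier_mat mult_carrier_mat)
  have lift: "?c (A_lift A B C KP KI KD h) =
      four_block_mat (1\<^sub>m (n + p) + complex_of_real h \<cdot>\<^sub>m ?c (slow_rate (G h) (F h))
        - ?c (derivative_input (G h)) * ?c output_row) (?c (derivative_input (G h))) (?c output_row) (0\<^sub>m p p)"
    if "h \<noteq> 0" for h
    unfolding A_lift_sheared[OF that, folded G_def F_def] of_real_hom.mat_hom_mult[OF Yc(1) Rc, symmetric]
    using Vc(1)[of h] Yc(1)[of h] Rc by (intro eq_matI) auto
  have "\<exists>lam :: nat \<Rightarrow> real \<Rightarrow> complex.
    (\<forall>\<^sub>F h in at_right 0. image_mset (\<lambda>j. lam j h) (mset_set {1..n+p+p}) =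
       proots (char_poly (four_block_mat (1\<^sub>m (n + p) + complex_of_real h \<cdot>\<^sub>m ?c (slow_rate (G h) (F h))
        - ?c (derivative_input (G h)) * ?c output_row) (?c (derivative_input (G h))) (?c output_row) (0\<^sub>m p p)))) \<and>
    (\<forall>j\<in>{1..n+p}. ((\<lambda>h. (lam j h - 1) / complex_of_real h) \<longlongrightarrow> \<mu> j) (at_right 0)) \<and>
    (\<forall>l\<in>{1..p}. (lam (n + p + l) \<longlongrightarrow> - \<nu> l) (at_right 0))"
  proof (rule slow_fast_eigenvalues)
    show "?c output_row \<in> carrier_mat p (n + p)" using Rc by simp
    show "?c (A_id A B C KP KI KD) \<in> carrier_mat (n + p) (n + p)"
      using slow_rate_A_id(2)[OF inv] by simp
    show "mat_tendsto (n + p) (n + p) (\<lambda>h. ?c (slow_rate (G h) (F h)))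
        ((1\<^sub>m (n + p) + ?c (derivative_input (1\<^sub>m n)) * ?c output_row) * ?c (A_id A B C KP KI KD)) (at_right 0)"
      using mat_tendsto_of_real[OF V]
      unfolding slow_rate_A_id(1)[OF inv] of_real_hom.mat_hom_mult[OF E_carrier slow_rate_A_id(2)[OF inv]] E_complex .
    show "mat_tendsto (n + p) p (\<lambda>h. ?c (derivative_input (G h))) (?c (derivative_input (1\<^sub>m n))) (at_right 0)"
      by (rule mat_tendsto_of_real[OF Y])
    show "det (1\<^sub>m (n + p) + ?c (derivative_input (1\<^sub>m n)) * ?c output_row) \<noteq> 0"
      unfolding E_complex[symmetric] of_real_hom.hom_det using slow_rate_A_id(3)[OF inv] by simp
    show "image_mset \<mu> (mset_set {1..n+p}) = proots (char_poly (?c (A_id A B C KP KI KD)))"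
      using \<mu> unfolding eigenvalues_mset_def .
    show "image_mset \<nu> (mset_set {1..p}) = proots (char_poly (?c output_row * ?c (derivative_input (1\<^sub>m n))))"
      using \<nu> unfolding eigenvalues_mset_def of_real_hom.mat_hom_mult[OF Rc Yc(2), symmetric]
        output_row_derivative_input .
  qed
  then obtain lam :: "nat \<Rightarrow> real \<Rightarrow> complex" where
    lam: "\<forall>\<^sub>F h in at_right 0. image_mset (\<lambda>j. lam j h) (mset_set {1..n+p+p}) =
       proots (char_poly (four_block_mat (1\<^sub>m (n + p) + complex_of_real h \<cdot>\<^sub>m ?c (slow_rate (G h) (F h))
        - ?c (derivative_input (G h)) * ?c output_row) (?c (derivative_input (G h))) (?c output_row) (0\<^sub>m p p)))"
    and limits: "\<forall>j\<in>{1..n+p}. ((\<lambda>h. (lam j h - 1) / complex_of_real h) \<longlongrightarrow> \<mu> j) (at_right 0)"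
      "\<forall>l\<in>{1..p}. (lam (n + p + l) \<longlongrightarrow> - \<nu> l) (at_right 0)" by blast
  from lam eventually_at_right_less[of "0::real"]
  have "\<forall>\<^sub>F h in at_right 0.
       image_mset (\<lambda>j. lam j h) (mset_set {1..n+p+p}) = eigenvalues_mset (A_lift A B C KP KI KD h)"
    by eventually_elim (simp add: eigenvalues_mset_def lift)
  with limits show ?thesis by (intro exI[of _ lam] conjI)
qed

end

theorem theorem1:
  fixes n m p :: nat
    and A B C KP KI KD :: "real mat"
    and \<mu> \<nu> :: "nat \<Rightarrow> complex"
  assumes "n > 0" and "m > 0" and "p > 0"
    and "A \<in> carrier_mat n n" and "B \<in> carrier_mat n m" and "C \<in> carrier_mat p n"
    and "KP \<in> carrier_mat m p" and "KI \<in> carrier_mat m p" and "KD \<in> carrier_mat m p"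
    and "invertible_mat (E_mat A B C KD)"
    and "image_mset \<mu> (mset_set {1..n+p}) = eigenvalues_mset (A_id A B C KP KI KD)"
    and "image_mset \<nu> (mset_set {1..p}) = eigenvalues_mset (C * B * KD)"
  shows "\<exists>lam :: nat \<Rightarrow> real \<Rightarrow> complex.
    (\<forall>\<^sub>F h in at_right 0.
       image_mset (\<lambda>j. lam j h) (mset_set {1..n+2*p}) = eigenvalues_mset (A_lift A B C KP KI KD h)) \<and>
    (\<forall>j\<in>{1..n+p}.
       (\<lambda>h. lam j h - (1 + complex_of_real h * \<mu> j)) \<in> o[at_right 0](\<lambda>h. complex_of_real h)) \<and>
    (\<forall>l\<in>{1..p}. ((\<lambda>h. lam (n + p + l) h) \<longlongrightarrow> - \<nu> l) (at_right 0))"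
proof -
  obtain lam :: "nat \<Rightarrow> real \<Rightarrow> complex" where
    labels: "\<forall>\<^sub>F h in at_right 0.
      image_mset (\<lambda>j. lam j h) (mset_set {1..n+p+p}) = eigenvalues_mset (A_lift A B C KP KI KD h)"
    and slow: "\<And>j. j \<in> {1..n+p} \<Longrightarrow> ((\<lambda>h. (lam j h - 1) / complex_of_real h) \<longlongrightarrow> \<mu> j) (at_right 0)"
    and fast: "\<forall>l\<in>{1..p}. (lam (n + p + l) \<longlongrightarrow> - \<nu> l) (at_right 0)"
    using pid_eigenvalues[OF assms(4-12)]
    by (elim exE conjE) (rule that, assumption, erule (1) bspec, assumption)
  have small: "(\<lambda>h. lam j h - (1 + complex_of_real h * \<mu> j)) \<in> o[at_right 0](\<lambda>h. complex_of_real h)"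
    if "j \<in> {1..n+p}" for j
  proof (rule smalloI_tendsto)
    have pos: "\<forall>\<^sub>F h in at_right 0. complex_of_real h \<noteq> 0"
      using eventually_at_right_less[of "0::real"] by eventually_elim simp
    then show "\<forall>\<^sub>F h in at_right 0. complex_of_real h \<noteq> 0" .
    have "((\<lambda>h. (lam j h - 1) / complex_of_real h - \<mu> j) \<longlongrightarrow> 0) (at_right 0)"
      by (rule LIM_zero[OF slow[OF that]])
    moreover have "\<forall>\<^sub>F h in at_right 0. (lam j h - 1) / complex_of_real h - \<mu> j
        = (lam j h - (1 + complex_of_real h * \<mu> j)) / complex_of_real h"
      using pos by eventually_elim (simp add: field_simps)
    ultimately show "((\<lambda>h. (lam j h - (1 + complex_of_real h * \<mu> j)) / complex_of_real h) \<longlongrightarrow> 0) (at_right 0)"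
      by (rule Lim_transform_eventually)
  qed
  have "n + p + p = n + 2 * p" by simp
  from labels[unfolded this] small fast show ?thesis
    by (intro exI[of _ lam] conjI ballI) (assumption | erule bspec)+
qed

end
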